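(* Let $W$ be a finite real reflection group, let $T$ be the set of all reflections in $W$, and let $c \in W$ be a Coxeter element. Let $\mathbf{t}=(t_1,\ldots,t_m)$ and $\mathbf{t}'=(t'_1,\ldots,t'_{m'})$ be two reflection factorizations of $c$ (of arbitrary lengths), i.e. all $t_i,t'_j\in T$ and $t_1\cdots t_m = c = t'_1\cdots t'_{m'}$. Then $\mathbf{t}$ and $\mathbf{t}'$ lie in the same Hurwitz orbit if and only if they share the same multiset of conjugacy classes, i.e. the multiset of $W$-conjugacy classes of $t_1,\ldots,t_m$ equals the multiset of $W$-conjugacy classes of $t'_1,\ldots,t'_{m'}$.
   Context: Let $(V,\langle\cdot,\cdot\rangle)$ be a finite-dimensional real Euclidean space. For $0\neq\alpha\in V$ the reflection $s_\alpha$ is $s_\alpha(v)=v-\frac{2\langle v,\alpha\rangle}{|\alpha|^2}\alpha$. A finite (real) reflection group $W$ is a finite group of linear maps of $V$ generated by its subset $T$ of reflections $s_\alpha\in W$; it is assumed that $W$ has no nonzero fixed vector in $V$. A root system $\Phi$ for $W$ is a $W$-stable subset of $V$ consisting of a choice of two opposite normal vectors $\pm\alpha$ for each reflecting hyperplane of a reflection in $T$. An open Weyl chamber $F$ is a connected component of the complement in $V$ of the union of all reflecting hyperplanes; the associated simple roots $\Pi\subset\Phi$ are the inward-pointing normal vectors (in $\Phi$) to the walls of $\overline F$. A Coxeter element of $W$ is any element of the form $c=s_{\alpha_1}s_{\alpha_2}\cdots s_{\alpha_n}$, where $(\alpha_1,\ldots,\alpha_n)$ is any ordering of any choice of simple roots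 $\Pi=\{\alpha_1,\ldots,\alpha_n\}$ for $\Phi$. Hurwitz action: write $a^b:=b^{-1}ab$. For $1\le i\le m-1$ the Hurwitz move $\sigma_i$ sends $(t_1,\ldots,t_m)$ to $(t_1,\ldots,t_{i-1},\,t_{i+1},\,t_i^{t_{i+1}},\,t_{i+2},\ldots,t_m)$. It is invertible and preserves the product. The moves generate an action of the braid group on $m$ strands on the length-$m$ factorizations of a given element into reflections; its orbits are called Hurwitz orbits. *)

theory Defs
  imports "HOL-Analysis.Analysis" "HOL-Algebra.Generated_Groups" "HOL-Library.Multiset"
begin

section \<open>Finite real reflection groups\<close>

definition hyperplane :: "'a::euclidean_space \<Rightarrow> 'a set"
  where "hyperplane \<alpha> = {v. v \<bullet> \<alpha> = 0}"

definition reflection :: "'a::euclidean_space \<Rightarrow> 'a \<Rightarrow> 'a"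
  where "reflection \<alpha> v = v - (2 * (v \<bullet> \<alpha>) / (norm \<alpha>)\<^sup>2) *\<^sub>R \<alpha>"

text \<open>A set of maps regarded as a group under composition; products are read as
  \<open>(f \<otimes> g) v = f (g v)\<close>.\<close>

definition map_group :: "('a \<Rightarrow> 'a) set \<Rightarrow> ('a \<Rightarrow> 'a) monoid"
  where "map_group W = \<lparr>carrier = W, monoid.mult = (\<circ>), one = id\<rparr>"

definition reflections :: "('a::euclidean_space \<Rightarrow> 'a) set \<Rightarrow> ('a \<Rightarrow> 'a) set"
  where "reflections W = {t \<in> W. \<exists>\<alpha>. \<alpha> \<noteq> 0 \<and> t = reflection \<alpha>}"

definition finite_reflection_group :: "('a::euclidean_space \<Rightarrow> 'a) set \<Rightarrow> bool"
  where "finite_reflection_group W \<longleftrightarrow>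
    finite W \<and> (\<forall>w\<in>W. linear w) \<and> group (map_group W) \<and>
    generate (map_group W) (reflections W) = W"

definition essential :: "('a::euclidean_space \<Rightarrow> 'a) set \<Rightarrow> bool"
  where "essential W \<longleftrightarrow> (\<forall>v. (\<forall>w\<in>W. w v = v) \<longrightarrow> v = 0)"

definition reflecting_hyperplanes :: "('a::euclidean_space \<Rightarrow> 'a) set \<Rightarrow> 'a set set"
  where "reflecting_hyperplanes W = {hyperplane \<alpha> | \<alpha>. \<alpha> \<noteq> 0 \<and> reflection \<alpha> \<in> W}"

text \<open>The normal vectors of a hyperplane \<open>H\<close> are the nonzero \<open>\<alpha>\<close> with \<open>hyperplane \<alpha> = H\<close>
  (and \<open>hyperplane 0\<close> is the whole space, never a reflecting hyperplane).\<close>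

definition root_system :: "('a::euclidean_space \<Rightarrow> 'a) set \<Rightarrow> 'a set \<Rightarrow> bool"
  where "root_system W \<Phi> \<longleftrightarrow>
    (\<forall>w\<in>W. \<forall>\<alpha>\<in>\<Phi>. w \<alpha> \<in> \<Phi>) \<and>
    (\<forall>\<alpha>\<in>\<Phi>. hyperplane \<alpha> \<in> reflecting_hyperplanes W) \<and>
    (\<forall>H\<in>reflecting_hyperplanes W. \<exists>\<alpha>. \<alpha> \<noteq> 0 \<and> {\<beta> \<in> \<Phi>. hyperplane \<beta> = H} = {\<alpha>, - \<alpha>})"

definition weyl_chamber :: "('a::euclidean_space \<Rightarrow> 'a) set \<Rightarrow> 'a set \<Rightarrow> bool"
  where "weyl_chamber W F \<longleftrightarrow> F \<in> components (- \<Union>(reflecting_hyperplanes W))"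

text \<open>A wall is a reflecting hyperplane that supports a face of codimension one of the closed
  chamber.\<close>

definition walls :: "('a::euclidean_space \<Rightarrow> 'a) set \<Rightarrow> 'a set \<Rightarrow> 'a set set"
  where "walls W F = {H \<in> reflecting_hyperplanes W. (H \<inter> closure F) facet_of closure F}"

definition simple_roots ::
    "('a::euclidean_space \<Rightarrow> 'a) set \<Rightarrow> 'a set \<Rightarrow> 'a set \<Rightarrow> 'a set"
  where "simple_roots W \<Phi> F = {\<alpha> \<in> \<Phi>. hyperplane \<alpha> \<in> walls W F \<and> (\<forall>v\<in>F. 0 < v \<bullet> \<alpha>)}"

section \<open>Factorizations and the Hurwitz action\<close>

definition list_prod :: "('g, 'b) monoid_scheme \<Rightarrow> 'g list \<Rightarrow> 'g"
  where "list_prod G ts = foldr (mult G) ts \<one>\<^bsub>G\<^esub>"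

definition coxeter_element :: "('a::euclidean_space \<Rightarrow> 'a) set \<Rightarrow> ('a \<Rightarrow> 'a) \<Rightarrow> bool"
  where "coxeter_element W c \<longleftrightarrow>
    (\<exists>\<Phi> F \<alpha>s. root_system W \<Phi> \<and> weyl_chamber W F \<and>
       distinct \<alpha>s \<and> set \<alpha>s = simple_roots W \<Phi> F \<and>
       c = list_prod (map_group W) (map reflection \<alpha>s))"

definition reflection_factorization ::
    "('a::euclidean_space \<Rightarrow> 'a) set \<Rightarrow> ('a \<Rightarrow> 'a) \<Rightarrow> ('a \<Rightarrow> 'a) list \<Rightarrow> bool"
  where "reflection_factorization W c ts \<longleftrightarrow>
    set ts \<subseteq> reflections W \<and> list_prod (map_group W) ts = c"

definition conj_by :: "('g, 'b) monoid_scheme \<Rightarrow> 'g \<Rightarrow> 'g \<Rightarrow> 'g"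
  where "conj_by G a b = inv\<^bsub>G\<^esub> b \<otimes>\<^bsub>G\<^esub> a \<otimes>\<^bsub>G\<^esub> b"

definition conj_class :: "('g, 'b) monoid_scheme \<Rightarrow> 'g \<Rightarrow> 'g set"
  where "conj_class G a = {conj_by G a b | b. b \<in> carrier G}"

text \<open>Positions are counted from \<open>0\<close>, so this is the move \<open>\<sigma>\<close> with index \<open>i + 1\<close>.\<close>

definition hurwitz_move :: "('g, 'b) monoid_scheme \<Rightarrow> nat \<Rightarrow> 'g list \<Rightarrow> 'g list"
  where "hurwitz_move G i ts =
    ts[i := ts ! Suc i, Suc i := conj_by G (ts ! i) (ts ! Suc i)]"

definition hurwitz_step :: "('g, 'b) monoid_scheme \<Rightarrow> 'g list \<Rightarrow> 'g list \<Rightarrow> bool"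
  where "hurwitz_step G ts us \<longleftrightarrow>
    set ts \<subseteq> carrier G \<and> (\<exists>i. Suc i < length ts \<and> us = hurwitz_move G i ts)"

text \<open>The orbits of the group generated by the invertible Hurwitz moves are the classes of the
  equivalence relation generated by the moves. A move and its inverse turn reflection
  factorizations of \<open>c\<close> into reflection factorizations of \<open>c\<close>.\<close>

definition same_hurwitz_orbit :: "('g, 'b) monoid_scheme \<Rightarrow> 'g list \<Rightarrow> 'g list \<Rightarrow> bool"
  where "same_hurwitz_orbit G = equivclp (hurwitz_step G)"

end

theory Submission
  imports Defs
begin

text \<open>
  A factorization \<open>t\<^sub>1 \<dots> t\<^sub>m\<close> of \<open>c\<close> is a path in \<open>W\<close> from the identity to \<open>c\<close> through the partial products.
  Fix a point \<open>\<rho>\<close> of the chamber and call \<open>w \<rho> \<bullet> \<rho>\<close> the height of \<open>w\<close>. If a path has a dip, that is, two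
  steps \<open>t \<noteq> t'\<close> such that the point between them is lower than both of its neighbours, then a
  Hurwitz move at this place, or its inverse, replaces the point by a higher one
  (\<open>height_dip\<close>; this is an inequality in the plane of the two roots, \<open>reflection_pair_toward\<close>). So a
  factorization of maximal total height in its Hurwitz orbit either has two equal neighbouring
  entries, or its path falls at each step (\<open>hurwitz_pair_or_descent\<close>).

  Let \<open>c = s\<^sub>1 \<dots> s\<^sub>n\<close> be a product of distinct simple reflections. Equal neighbours \<open>t, t\<close> can be moved to
  the front, and the other entries factor \<open>c\<close> again. If the path falls in the last step \<open>t\<close>, the exchange
  property says that \<open>t\<close> is the entry that arises when some \<open>s\<^sub>i\<close> is moved to the end of
  \<open>s\<^sub>1, \<dots>, s\<^sub>n\<close> by Hurwitz moves. Then the remaining entries factor the product without \<open>s\<^sub>i\<close>. By induction on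
  the length each factorization of \<open>c\<close> lies in the orbit of a list
  \<open>r\<^sub>1, r\<^sub>1, \<dots>, r\<^sub>k, r\<^sub>k, s\<^sub>1, \<dots>, s\<^sub>n\<close> (\<open>hurwitz_normal_form\<close>).

  In such a list a pair \<open>r, r\<close> can be moved freely, and conjugated by any entry that it passes. The simple
  reflections generate \<open>W\<close> (\<open>generate_simple\<close>), so only the conjugacy classes of the \<open>r\<^sub>i\<close> matter
  (\<open>hurwitz_doubled\<close>), and these are determined by the classes of the original entries. Conversely a
  Hurwitz move only permutes entries and conjugates one of them, so it keeps the multiset of classes.

  What has to be known about simple roots is derived from the facets of the closed chamber
  (\<open>simple_system_simple_roots\<close>).
\<close>

section \<open>Hurwitz moves in a group\<close>

text \<open>The normal form of a reflection factorization of a Coxeter element has this list in front of the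
  simple reflections.\<close>

definition doubled :: "'g list \<Rightarrow> 'g list"
  where "doubled rs = concat (map (\<lambda>r. [r, r]) rs)"

lemma doubled_simps [simp]:
  "doubled [] = []" "doubled (r # rs) = r # r # doubled rs"
  "doubled (rs @ rs') = doubled rs @ doubled rs'" "set (doubled rs) = set rs"
  "mset (doubled rs) = mset rs + mset rs"
  by (induction rs) (auto simp: doubled_def)

context group
begin

abbreviation hurwitz_equiv :: "'a list \<Rightarrow> 'a list \<Rightarrow> bool" (infix "\<sim>\<^sub>H" 50)
  where "ts \<sim>\<^sub>H us \<equiv> same_hurwitz_orbit G ts us"

lemma hurwitz_refl: "ts \<sim>\<^sub>H ts"
  by (simp add: same_hurwitz_orbit_def)

lemma hurwitz_sym: "ts \<sim>\<^sub>H us \<Longrightarrow> us \<sim>\<^sub>H ts"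
  by (simp add: same_hurwitz_orbit_def equivclp_sym)

lemma hurwitz_trans [trans]: "ts \<sim>\<^sub>H us \<Longrightarrow> us \<sim>\<^sub>H vs \<Longrightarrow> ts \<sim>\<^sub>H vs"
  unfolding same_hurwitz_orbit_def by (rule equivclp_trans)

lemma conj_by_closed: "a \<in> carrier G \<Longrightarrow> b \<in> carrier G \<Longrightarrow> conj_by G a b \<in> carrier G"
  by (simp add: conj_by_def)

lemma conj_by_conj_by:
  "a \<in> carrier G \<Longrightarrow> b \<in> carrier G \<Longrightarrow> d \<in> carrier G \<Longrightarrow>
    conj_by G (conj_by G a b) d = conj_by G a (b \<otimes> d)"
  by (simp add: conj_by_def inv_mult_group m_assoc)

lemma conj_class_conj_by:
  assumes "a \<in> carrier G" "b \<in> carrier G"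
  shows "conj_class G (conj_by G a b) = conj_class G a"
proof (intro subset_antisym subsetI)
  fix x assume "x \<in> conj_class G (conj_by G a b)"
  then obtain d where "d \<in> carrier G" "x = conj_by G (conj_by G a b) d"
    by (auto simp: conj_class_def)
  then show "x \<in> conj_class G a"
    using assms by (auto simp: conj_class_def conj_by_conj_by)
next
  fix x assume "x \<in> conj_class G a"
  then obtain d where d: "d \<in> carrier G" "x = conj_by G a d"
    by (auto simp: conj_class_def)
  then have "x = conj_by G (conj_by G a b) (inv b \<otimes> d)"
    using assms by (simp add: conj_by_conj_by m_assoc[symmetric])
  then show "x \<in> conj_class G (conj_by G a b)"
    using assms d by (auto simp: conj_class_def)
qed

lemma hurwitz_move_append:
  "hurwitz_move G (length xs) (xs @ a # b # ys) = xs @ b # conj_by G a b # ys"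
  by (simp add: hurwitz_move_def nth_append list_update_append)

text \<open>Splitting the list at the moved pair replaces index arithmetic by list patterns, on which all later
  arguments work.\<close>

lemma hurwitz_step_iff:
  "hurwitz_step G ts us \<longleftrightarrow>
    (\<exists>xs a b ys. ts = xs @ a # b # ys \<and> us = xs @ b # conj_by G a b # ys \<and> set ts \<subseteq> carrier G)"
proof
  assume "hurwitz_step G ts us"
  then obtain i where i: "Suc i < length ts" "us = hurwitz_move G i ts" and c: "set ts \<subseteq> carrier G"
    by (auto simp: hurwitz_step_def)
  define xs where "xs = take i ts"
  have l: "length xs = i" using i by (simp add: xs_def)
  have "ts = xs @ ts ! i # ts ! Suc i # drop (Suc (Suc i)) ts"
    using i by (simp add: xs_def Cons_nth_drop_Suc)
  with i c l show "\<exists>xs a b ys. ts = xs @ a # b # ys \<and> us = xs @ b # conj_by G a b # ys \<and> set ts \<subseteq> carrier G"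
    by (metis hurwitz_move_append)
next
  assume "\<exists>xs a b ys. ts = xs @ a # b # ys \<and> us = xs @ b # conj_by G a b # ys \<and> set ts \<subseteq> carrier G"
  then obtain xs a b ys where *: "ts = xs @ a # b # ys" "us = xs @ b # conj_by G a b # ys"
    "set ts \<subseteq> carrier G" by blast
  then have "us = hurwitz_move G (length xs) ts" by (simp add: hurwitz_move_append)
  with * show "hurwitz_step G ts us" unfolding hurwitz_step_def
    by (intro conjI exI[of _ "length xs"]) auto
qed

lemma hurwitz_swap: "a \<in> carrier G \<Longrightarrow> b \<in> carrier G \<Longrightarrow> [a, b] \<sim>\<^sub>H [b, conj_by G a b]"
  unfolding same_hurwitz_orbit_def
  by (rule r_into_equivclp) (auto simp: hurwitz_step_iff intro!: exI[of _ "[]"])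

text \<open>The orbit relation is generated by the moves as an equivalence relation, so a relation that is
  itself symmetric and transitive has to be checked on single moves only.\<close>

lemma hurwitz_induct [consumes 1, case_names refl move]:
  assumes "ts \<sim>\<^sub>H us"
    and "\<And>ts. R ts ts"
    and "\<And>xs a b ys ts us. \<lbrakk>ts = xs @ a # b # ys; us = xs @ b # conj_by G a b # ys; set xs \<subseteq> carrier G;
      set ys \<subseteq> carrier G; a \<in> carrier G; b \<in> carrier G\<rbrakk> \<Longrightarrow> R ts us"
    and "symp R" "transp R"
  shows "R ts us"
  using assms(1) unfolding same_hurwitz_orbit_def
proof (induction rule: equivclp_induct)
  case base
  show ?case by (rule assms(2))
next
  case (step us vs)
  have "R xs ys" if "hurwitz_step G xs ys" for xs ys
    using that assms(3) unfolding hurwitz_step_iff by auto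
  with step have "R us vs" using \<open>symp R\<close> by (meson sympD)
  with step show ?case using \<open>transp R\<close> by (meson transpD)
qed

lemma hurwitz_append:
  assumes "ts \<sim>\<^sub>H us" "set xs \<subseteq> carrier G" "set ys \<subseteq> carrier G"
  shows "xs @ ts @ ys \<sim>\<^sub>H xs @ us @ ys"
  using assms(1)
proof (induction rule: hurwitz_induct)
  case (move zs a b ws ts us)
  have "hurwitz_step G (xs @ ts @ ys) (xs @ us @ ys)"
    unfolding hurwitz_step_iff using move assms
    by (intro exI[of _ "xs @ zs"] exI[of _ a] exI[of _ b] exI[of _ "ws @ ys"]) auto
  then show ?case by (auto simp: same_hurwitz_orbit_def)
qed (auto intro: hurwitz_refl hurwitz_sym hurwitz_trans sympI transpI)

text \<open>A move replaces one entry by a conjugate of it, and the replaced entry is again a conjugate of the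
  new one; this gives both directions.\<close>

lemma hurwitz_closed_under_conj:
  assumes "ts \<sim>\<^sub>H us" "T \<subseteq> carrier G" "\<And>t u. t \<in> T \<Longrightarrow> u \<in> carrier G \<Longrightarrow> conj_by G t u \<in> T"
  shows "set ts \<subseteq> T \<longleftrightarrow> set us \<subseteq> T"
  using assms(1)
proof (induction rule: hurwitz_induct)
  case (move xs a b ys ts us)
  have "conj_by G (conj_by G a b) (inv b) = a"
    using move by (simp add: conj_by_conj_by) (simp add: conj_by_def)
  then show ?case using move assms(3)[of a b] assms(3)[of "conj_by G a b" "inv b"] by auto
qed (auto intro: sympI transpI)

lemma hurwitz_length: "ts \<sim>\<^sub>H us \<Longrightarrow> length ts = length us"
  by (induction rule: hurwitz_induct) (auto intro: sympI transpI)

lemma list_prod_closed: "set ts \<subseteq> carrier G \<Longrightarrow> list_prod G ts \<in> carrier G"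
  by (induction ts) (auto simp: list_prod_def)

lemma list_prod_simps [simp]: "list_prod G [] = \<one>" "list_prod G (t # ts) = t \<otimes> list_prod G ts"
  by (auto simp: list_prod_def)

lemma list_prod_append:
  "set ts \<subseteq> carrier G \<Longrightarrow> set us \<subseteq> carrier G \<Longrightarrow>
    list_prod G (ts @ us) = list_prod G ts \<otimes> list_prod G us"
  by (induction ts) (auto simp: list_prod_closed m_assoc)

lemma hurwitz_list_prod: "ts \<sim>\<^sub>H us \<Longrightarrow> list_prod G ts = list_prod G us"
proof (induction rule: hurwitz_induct)
  case (move xs a b ys ts us)
  then have "b \<otimes> (conj_by G a b \<otimes> list_prod G ys) = a \<otimes> (b \<otimes> list_prod G ys)"
    by (simp add: conj_by_def list_prod_closed m_assoc[symmetric])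
  with move show ?case by (simp add: list_prod_append conj_by_closed)
qed (auto intro: sympI transpI)

lemma hurwitz_conj_classes:
  "ts \<sim>\<^sub>H us \<Longrightarrow> image_mset (conj_class G) (mset ts) = image_mset (conj_class G) (mset us)"
  by (induction rule: hurwitz_induct) (auto intro: sympI transpI simp: conj_class_conj_by)

lemma hurwitz_move_to_end:
  assumes "s \<in> carrier G" "set bs \<subseteq> carrier G"
  shows "s # bs \<sim>\<^sub>H bs @ [conj_by G s (list_prod G bs)]"
  using assms
proof (induction bs arbitrary: s)
  case Nil
  then show ?case by (simp add: conj_by_def hurwitz_refl)
next
  case (Cons b bs)
  have "s # b # bs \<sim>\<^sub>H b # conj_by G s b # bs"
    using hurwitz_append[OF hurwitz_swap[of s b], of "[]" bs] Cons.prems by simp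
  also have "\<dots> \<sim>\<^sub>H b # bs @ [conj_by G (conj_by G s b) (list_prod G bs)]"
    using hurwitz_append[OF Cons.IH[of "conj_by G s b"], of "[b]" "[]"] Cons.prems
    by (simp add: conj_by_closed)
  finally show ?case
    using Cons.prems by (simp add: conj_by_conj_by list_prod_closed)
qed

text \<open>Passing an entry \<open>u\<close> over \<open>[t, t]\<close> conjugates it by \<open>t\<close> twice, and \<open>t\<close> is an involution.\<close>

lemma hurwitz_pair_commute:
  assumes "t \<in> carrier G" "t \<otimes> t = \<one>" "set us \<subseteq> carrier G"
  shows "us @ [t, t] \<sim>\<^sub>H [t, t] @ us"
  using assms(3)
proof (induction us)
  case Nil
  show ?case by (simp add: hurwitz_refl)
next
  case (Cons u us)
  have u: "u \<in> carrier G" using Cons.prems by simp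
  have "(u # us) @ [t, t] \<sim>\<^sub>H [u, t, t] @ us"
    using hurwitz_append[OF Cons.IH, of "[u]" "[]"] Cons.prems by simp
  also have "[u, t, t] @ us \<sim>\<^sub>H [t, t, conj_by G u (list_prod G [t, t])] @ us"
    using hurwitz_append[OF hurwitz_move_to_end[of u "[t, t]"], of "[]" us] assms Cons.prems by simp
  also have "conj_by G u (list_prod G [t, t]) = u"
    using assms u by (simp add: conj_by_def)
  finally show ?case by simp
qed

lemma hurwitz_pair_front:
  assumes "t \<in> carrier G" "t \<otimes> t = \<one>" "set us \<subseteq> carrier G" "set vs \<subseteq> carrier G"
  shows "us @ t # t # vs \<sim>\<^sub>H t # t # us @ vs"
  using hurwitz_append[OF hurwitz_pair_commute[OF assms(1-3)], of "[]" vs] assms by simp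

lemma conj_by_involution:
  assumes "t \<in> carrier G" "t \<otimes> t = \<one>" "g \<in> carrier G"
  shows "conj_by G t g \<otimes> conj_by G t g = \<one>"
proof -
  have "conj_by G t g \<otimes> conj_by G t g = inv g \<otimes> ((t \<otimes> (g \<otimes> inv g)) \<otimes> t) \<otimes> g"
    using assms by (simp only: conj_by_def m_assoc m_closed inv_closed)
  then show ?thesis using assms by simp
qed

text \<open>The pair travels to the place just left of \<open>s\<close>. Passing \<open>s\<close> over it to the left conjugates both
  of its entries by \<open>s\<close> and leaves \<open>s\<close> unchanged; then the pair travels back.\<close>

lemma hurwitz_pair_conj_member:
  assumes t: "t \<in> carrier G" "t \<otimes> t = \<one>" and us: "set us \<subseteq> carrier G" "s \<in> set us"
  shows "t # t # us \<sim>\<^sub>H conj_by G t s # conj_by G t s # us"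
proof -
  obtain vs ws where v: "us = vs @ s # ws" using us by (meson split_list)
  let ?r = "conj_by G t s"
  have s: "s \<in> carrier G" "set vs \<subseteq> carrier G" "set ws \<subseteq> carrier G" using us v by auto
  have r: "?r \<in> carrier G" "?r \<otimes> ?r = \<one>"
    using t s by (auto simp: conj_by_closed conj_by_involution)
  have 1: "[t, t, s] \<sim>\<^sub>H [t, s, ?r]"
    using hurwitz_append[OF hurwitz_swap[of t s], of "[t]" "[]"] t s by simp
  have 2: "[t, s, ?r] \<sim>\<^sub>H [s, ?r, ?r]"
    using hurwitz_append[OF hurwitz_swap[of t s], of "[]" "[?r]"] t s r by simp
  have "t # t # us \<sim>\<^sub>H vs @ [t, t, s] @ ws"
    using hurwitz_pair_front[OF t, of vs "s # ws"] s v by (auto intro: hurwitz_sym)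
  also have "\<dots> \<sim>\<^sub>H vs @ [s, ?r, ?r] @ ws"
    by (rule hurwitz_append[OF hurwitz_trans[OF 1 2]]) (use s in auto)
  also have "\<dots> \<sim>\<^sub>H ?r # ?r # us"
    using hurwitz_pair_front[OF r, of "vs @ [s]" ws] s v by simp
  finally show ?thesis .
qed

lemma hurwitz_pair_conj_inv:
  assumes t: "t \<in> carrier G" "t \<otimes> t = \<one>" and us: "set us \<subseteq> carrier G" "s \<in> set us"
  shows "t # t # us \<sim>\<^sub>H conj_by G t (inv s) # conj_by G t (inv s) # us"
proof -
  have s: "s \<in> carrier G" using us by auto
  let ?r = "conj_by G t (inv s)"
  have "conj_by G ?r s = t"
    using t s by (simp add: conj_by_conj_by) (simp add: conj_by_def)
  then show ?thesis
    using hurwitz_pair_conj_member[of ?r us s] t s us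
    by (simp add: conj_by_closed conj_by_involution hurwitz_sym)
qed

lemma hurwitz_pair_conj:
  assumes t: "t \<in> carrier G" "t \<otimes> t = \<one>" and us: "set us \<subseteq> carrier G"
    and g: "g \<in> generate G (set us)"
  shows "t # t # us \<sim>\<^sub>H conj_by G t g # conj_by G t g # us"
  using g t
proof (induction arbitrary: t)
  case one
  then show ?case by (simp add: conj_by_def hurwitz_refl)
next
  case (incl s)
  then show ?case using hurwitz_pair_conj_member us by auto
next
  case (inv s)
  then show ?case using hurwitz_pair_conj_inv us by auto
next
  case (eng g h)
  have gh: "g \<in> carrier G" "h \<in> carrier G"
    using eng.hyps us generate_in_carrier by auto
  have "t # t # us \<sim>\<^sub>H conj_by G t g # conj_by G t g # us"
    using eng by blast
  also have "\<dots> \<sim>\<^sub>H conj_by G (conj_by G t g) h # conj_by G (conj_by G t g) h # us"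
    using eng gh by (intro eng.IH(2)) (auto simp: conj_by_closed conj_by_involution)
  finally show ?case using eng gh by (simp add: conj_by_conj_by)
qed

text \<open>Since the tail \<open>ss\<close> generates the group, each pair can be conjugated to any member of its class
  without changing the other entries. Matching the pairs one after the other turns one list of
  pairs into the other.\<close>

lemma hurwitz_doubled:
  assumes ss: "set ss \<subseteq> carrier G" "generate G (set ss) = carrier G"
    and "set rs \<subseteq> {t \<in> carrier G. t \<otimes> t = \<one>}" "set rs' \<subseteq> {t \<in> carrier G. t \<otimes> t = \<one>}"
    and "image_mset (conj_class G) (mset rs) = image_mset (conj_class G) (mset rs')"
  shows "doubled rs @ ss \<sim>\<^sub>H doubled rs' @ ss"
  using assms(3-)
proof (induction rs arbitrary: rs')
  case Nil
  then show ?case by (simp add: hurwitz_refl)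
next
  case (Cons r rs)
  let ?I = "{t \<in> carrier G. t \<otimes> t = \<one>}"
  have "conj_class G r \<in># image_mset (conj_class G) (mset rs')"
    unfolding Cons.prems(3)[symmetric] by simp
  then obtain r' where r': "r' \<in> set rs'" "conj_class G r = conj_class G r'" by auto
  then obtain us vs where rs': "rs' = us @ r' # vs" by (meson split_list)
  have I: "r \<in> ?I" "r' \<in> ?I" "set rs \<subseteq> ?I" "set us \<subseteq> ?I" "set vs \<subseteq> ?I" using Cons.prems rs' by auto
  have "conj_by G r \<one> \<in> conj_class G r" unfolding conj_class_def by blast
  then have "r \<in> conj_class G r'" using I r' by (simp add: conj_by_def)
  then obtain g where g: "g \<in> carrier G" "r = conj_by G r' g" by (auto simp: conj_class_def)
  have c: "set (doubled (us @ vs) @ ss) \<subseteq> carrier G" using I ss by auto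
  have "generate G (set ss) \<subseteq> generate G (set (doubled (us @ vs) @ ss))"
    by (rule mono_generate) auto
  then have g': "g \<in> generate G (set (doubled (us @ vs) @ ss))" using ss g by auto
  have tail: "doubled (us @ vs) @ ss \<sim>\<^sub>H doubled rs @ ss"
    by (rule hurwitz_sym, rule Cons.IH) (use I Cons.prems(3) r' rs' in auto)
  have "doubled rs' @ ss \<sim>\<^sub>H r' # r' # doubled (us @ vs) @ ss"
    using hurwitz_pair_front[of r' "doubled us" "doubled vs @ ss"] I ss rs' by auto
  also have "\<dots> \<sim>\<^sub>H r # r # doubled (us @ vs) @ ss"
    using hurwitz_pair_conj[OF _ _ c g', of r'] I g by auto
  also have "\<dots> \<sim>\<^sub>H r # r # doubled rs @ ss"
    using hurwitz_append[OF tail, of "[r, r]" "[]"] I by simp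
  finally show ?case by (simp add: hurwitz_sym)
qed

end

section \<open>Reflections\<close>

lemma reflection_alt: "reflection \<alpha> v = v - (2 * (v \<bullet> \<alpha>) / (\<alpha> \<bullet> \<alpha>)) *\<^sub>R \<alpha>"
  by (simp add: reflection_def power2_norm_eq_inner)

lemma linear_reflection: "linear (reflection \<alpha>)"
  by (rule linearI)
    (simp_all add: reflection_alt inner_add_left algebra_simps add_divide_distrib)

lemma reflection_reflection [simp]: "reflection \<alpha> (reflection \<alpha> v) = v"
  by (cases "\<alpha> = 0") (simp_all add: reflection_alt inner_diff_left algebra_simps flip: scaleR_add_left)

lemma reflection_comp_self [simp]: "reflection \<alpha> \<circ> reflection \<alpha> = id"
  by auto

lemma inner_reflection_left: "reflection \<alpha> u \<bullet> v = u \<bullet> reflection \<alpha> v"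
  by (simp add: reflection_alt inner_diff_left inner_diff_right inner_commute)

lemma reflection_inner: "reflection \<alpha> u \<bullet> reflection \<alpha> v = u \<bullet> v"
  by (simp add: inner_reflection_left)

lemma reflection_scaleR: "k \<noteq> 0 \<Longrightarrow> reflection (k *\<^sub>R \<alpha>) = reflection \<alpha>"
  by (rule ext) (simp add: reflection_alt)

lemma reflection_minus: "reflection (- \<alpha>) = reflection \<alpha>"
  using reflection_scaleR[of "-1" \<alpha>] by simp

lemma orthogonal_transformation_reflection: "orthogonal_transformation (reflection \<alpha>)"
  by (simp add: orthogonal_transformation_def linear_reflection reflection_inner)

lemma reflection_conj:
  assumes "orthogonal_transformation w"
  shows "reflection (w \<alpha>) (w v) = w (reflection \<alpha> v)"
  using assms
  by (simp add: reflection_alt orthogonal_transformation_def linear_diff linear_cmul)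

text \<open>The difference of \<open>\<beta>\<close> and its projection to the line of \<open>\<alpha>\<close> lies in the hyperplane of \<open>\<alpha>\<close>, hence in
  that of \<open>\<beta>\<close>, so it is orthogonal to itself.\<close>

lemma hyperplane_eq_iff:
  assumes "\<alpha> \<noteq> 0" "\<beta> \<noteq> 0"
  shows "hyperplane \<alpha> = hyperplane \<beta> \<longleftrightarrow> (\<exists>k. k \<noteq> 0 \<and> \<beta> = k *\<^sub>R \<alpha>)"
proof
  assume H: "hyperplane \<alpha> = hyperplane \<beta>"
  define k where "k = (\<beta> \<bullet> \<alpha>) / (\<alpha> \<bullet> \<alpha>)"
  define w where "w = \<beta> - k *\<^sub>R \<alpha>"
  have "w \<in> hyperplane \<alpha>"
    using assms by (simp add: hyperplane_def w_def k_def inner_diff_left)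
  then have "w \<bullet> \<alpha> = 0" "w \<bullet> \<beta> = 0"
    using H by (auto simp: hyperplane_def)
  then have "w \<bullet> w = 0"
    by (subst (2) w_def) (simp add: inner_diff_right)
  then have "\<beta> = k *\<^sub>R \<alpha>" by (simp add: w_def)
  with assms show "\<exists>k. k \<noteq> 0 \<and> \<beta> = k *\<^sub>R \<alpha>" by auto
qed (auto simp: hyperplane_def)

lemma hyperplane_eq_fixed: "\<alpha> \<noteq> 0 \<Longrightarrow> hyperplane \<alpha> = {v. reflection \<alpha> v = v}"
  by (auto simp: hyperplane_def reflection_alt)

lemma hyperplane_eq_iff_reflection_eq:
  assumes "\<alpha> \<noteq> 0" "\<beta> \<noteq> 0"
  shows "hyperplane \<alpha> = hyperplane \<beta> \<longleftrightarrow> reflection \<alpha> = reflection \<beta>"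
  using assms hyperplane_eq_iff[OF assms] reflection_scaleR[of _ \<alpha>]
  by (metis hyperplane_eq_fixed)

text \<open>Let \<open>a\<close> and \<open>b\<close> be the products of \<open>q\<close> with the two normal vectors, and \<open>A\<close> and \<open>B\<close> those of
  \<open>u\<close> with the normal vectors, suitably scaled and with the sign reversed. That each reflection alone moves
  \<open>q\<close> towards \<open>u\<close> means \<open>a * A > 0\<close> and \<open>b * B > 0\<close>. The gains from the two products of the reflections
  differ from \<open>a * A + b * B\<close> by multiples of \<open>b * A\<close> and \<open>a * B\<close>, with the inner product of the normal
  vectors as a factor. If neither gain were positive, multiplying the two inequalities would give
  \<open>(a * A + b * B)\<^sup>2 < 4 * (a * A) * (b * B)\<close> by the strict Cauchy-Schwarz inequality, against the
  inequality of arithmetic and geometric means.\<close>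

lemma reflection_pair_toward:
  assumes p: "q \<bullet> u < reflection \<alpha> q \<bullet> u" "q \<bullet> u < reflection \<beta> q \<bullet> u"
    and ne: "\<alpha> \<noteq> 0" "\<beta> \<noteq> 0" "reflection \<alpha> \<noteq> reflection \<beta>"
  shows "q \<bullet> u < reflection \<alpha> (reflection \<beta> q) \<bullet> u \<or> q \<bullet> u < reflection \<beta> (reflection \<alpha> q) \<bullet> u"
proof -
  define a b where "a = q \<bullet> \<alpha>" and "b = q \<bullet> \<beta>"
  define A B where "A = - 2 * (\<alpha> \<bullet> u) / (\<alpha> \<bullet> \<alpha>)" and "B = - 2 * (\<beta> \<bullet> u) / (\<beta> \<bullet> \<beta>)"
  define m n c where "m = \<alpha> \<bullet> \<alpha>" and "n = \<beta> \<bullet> \<beta>" and "c = \<alpha> \<bullet> \<beta>"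
  have mn: "m > 0" "n > 0" using ne by (auto simp: m_def n_def)
  have "c\<^sup>2 < m * n"
  proof -
    \<comment> \<open>Equality in Cauchy-Schwarz would make the normal vectors parallel.\<close>
    have "c\<^sup>2 \<noteq> m * n"
    proof
      assume "c\<^sup>2 = m * n"
      moreover have "(n *\<^sub>R \<alpha> - c *\<^sub>R \<beta>) \<bullet> (n *\<^sub>R \<alpha> - c *\<^sub>R \<beta>) = n * (n * m - c\<^sup>2)"
        by (simp add: inner_diff_left inner_diff_right m_def n_def c_def
            inner_commute algebra_simps power2_eq_square)
      ultimately have "(n *\<^sub>R \<alpha> - c *\<^sub>R \<beta>) \<bullet> (n *\<^sub>R \<alpha> - c *\<^sub>R \<beta>) = 0"
        by (simp add: mult.commute)
      then have "n *\<^sub>R \<alpha> = c *\<^sub>R \<beta>" by simp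
      then have "(1 / n) *\<^sub>R (n *\<^sub>R \<alpha>) = (1 / n) *\<^sub>R (c *\<^sub>R \<beta>)" by simp
      then have eq: "\<alpha> = (c / n) *\<^sub>R \<beta>" using mn by simp
      then have "c / n \<noteq> 0" using ne by auto
      with eq ne(3) show False using reflection_scaleR[of "c / n" \<beta>] by simp
    qed
    then show ?thesis
      using Cauchy_Schwarz_ineq[of \<alpha> \<beta>] by (simp add: m_def n_def c_def less_le)
  qed
  have aA: "a * A > 0" using p(1)
    by (simp add: reflection_alt inner_diff_left a_def A_def mult_ac)
  have bB: "b * B > 0" using p(2)
    by (simp add: reflection_alt inner_diff_left b_def B_def mult_ac)
  have 1: "reflection \<alpha> (reflection \<beta> q) \<bullet> u - q \<bullet> u = a * A + b * B - 2 * b * c / n * A"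
    using mn by (simp add: reflection_alt inner_diff_left inner_diff_right inner_add_right a_def b_def A_def B_def c_def m_def n_def
        inner_commute field_simps)
  have 2: "reflection \<beta> (reflection \<alpha> q) \<bullet> u - q \<bullet> u = a * A + b * B - 2 * a * c / m * B"
    using mn by (simp add: reflection_alt inner_diff_left inner_diff_right inner_add_right a_def b_def A_def B_def c_def m_def n_def
        inner_commute field_simps)
  show ?thesis
  proof (rule ccontr)
    assume "\<not> ?thesis"
    then have le: "a * A + b * B \<le> 2 * b * c / n * A" "a * A + b * B \<le> 2 * a * c / m * B"
      using 1 2 by linarith+
    have "(a * A + b * B) * (a * A + b * B) \<le> (2 * b * c / n * A) * (2 * a * c / m * B)"
      using le aA bB by (intro mult_mono) auto
    also have "\<dots> = 4 * (c\<^sup>2 / (m * n)) * ((a * A) * (b * B))"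
      by (simp add: power2_eq_square mult_ac)
    also have "\<dots> < 4 * 1 * ((a * A) * (b * B))"
      using \<open>c\<^sup>2 < m * n\<close> mn aA bB by (intro mult_strict_right_mono) (auto simp: divide_less_eq)
    finally show False
      using zero_le_square[of "a * A - b * B"] by (simp add: algebra_simps)
  qed
qed

section \<open>Heights of factorizations\<close>

lemma map_group_simps [simp]:
  "carrier (map_group W) = W" "mult (map_group W) = (\<circ>)" "one (map_group W) = id"
  by (simp_all add: map_group_def)

text \<open>A point off all reflecting hyperplanes decides which of two opposite roots is positive, namely the one
  with positive inner product, and its chamber will be the fundamental one.\<close>

locale regular_point =
  fixes W :: "('a::euclidean_space \<Rightarrow> 'a) set" and \<rho> :: 'a
  assumes reflection_group: "finite_reflection_group W"
    and regular: "\<alpha> \<noteq> 0 \<Longrightarrow> reflection \<alpha> \<in> W \<Longrightarrow> \<rho> \<bullet> \<alpha> \<noteq> 0"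
begin

sublocale G: group "map_group W"
  using reflection_group by (simp add: finite_reflection_group_def)

notation G.hurwitz_equiv (infix "\<sim>\<^sub>H" 50)

abbreviation prod_list_map ("\<Pi>\<^sub>L") where "\<Pi>\<^sub>L \<equiv> list_prod (map_group W)"

lemma finite_W: "finite W"
  and generate_reflections: "generate (map_group W) (reflections W) = W"
  using reflection_group by (simp_all add: finite_reflection_group_def)

lemma comp_closed [simp]: "v \<in> W \<Longrightarrow> w \<in> W \<Longrightarrow> v \<circ> w \<in> W"
  using G.m_closed by simp

lemma id_closed [simp]: "id \<in> W"
  using G.one_closed by simp

lemma reflections_subset: "reflections W \<subseteq> W"
  by (auto simp: reflections_def)

lemma reflection_involution: "t \<in> reflections W \<Longrightarrow> t \<circ> t = id"
  by (auto simp: reflections_def)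

lemma inv_reflection:
  assumes "t \<in> reflections W"
  shows "inv\<^bsub>map_group W\<^esub> t = t"
  using assms reflections_subset reflection_involution
  by (intro G.inv_equality) auto

lemma orthogonal_transformation_W:
  assumes "w \<in> W"
  shows "orthogonal_transformation w"
proof -
  have "w \<in> generate (map_group W) (reflections W)" using assms generate_reflections by simp
  then show ?thesis
  proof induction
    case one
    show ?case by (simp add: orthogonal_transformation_def linear_id)
  next
    case (incl t)
    then show ?case by (auto simp: reflections_def orthogonal_transformation_reflection)
  next
    case (inv t)
    then have "orthogonal_transformation t"
      by (auto simp: reflections_def orthogonal_transformation_reflection)
    with inv show ?case by (simp add: inv_reflection)
  next
    case (eng g h)
    then show ?case using orthogonal_transformation_compose[of g h] by (simp only: map_group_simps)
  qed
qed

lemma inner_inv: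
  assumes "w \<in> W"
  shows "u \<bullet> (inv\<^bsub>map_group W\<^esub> w) v = w u \<bullet> v"
proof -
  have "w ((inv\<^bsub>map_group W\<^esub> w) v) = v"
    using G.r_inv[of w] assms by (simp add: fun_eq_iff)
  then show ?thesis
    using orthogonal_transformation_W[OF assms]
    by (metis orthogonal_transformation_def)
qed

lemma conj_reflection:
  assumes "w \<in> W"
  shows "reflection (w \<alpha>) \<circ> w = w \<circ> reflection \<alpha>"
  using reflection_conj[OF orthogonal_transformation_W[OF assms]] by auto

lemma conj_reflection':
  assumes "w \<in> W"
  shows "reflection (w \<alpha>) = w \<circ> reflection \<alpha> \<circ> inv\<^bsub>map_group W\<^esub> w"
proof -
  have "w \<circ> inv\<^bsub>map_group W\<^esub> w = id" using G.r_inv[of w] assms by simp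
  then show ?thesis using conj_reflection[OF assms, of \<alpha>]
    by (metis comp_assoc comp_id)
qed

text \<open>Every nonzero normal vector of a reflecting hyperplane counts as a root, whatever its length; reflections and
  signs depend on its direction only.\<close>

definition is_root :: "'a \<Rightarrow> bool"
  where "is_root \<alpha> \<longleftrightarrow> \<alpha> \<noteq> 0 \<and> reflection \<alpha> \<in> W"

lemma W_nonzero: "w \<in> W \<Longrightarrow> \<alpha> \<noteq> 0 \<Longrightarrow> w \<alpha> \<noteq> 0"
  using orthogonal_transformation_W orthogonal_transformation_norm by (metis norm_eq_zero)

lemma is_root_image: "is_root \<alpha> \<Longrightarrow> w \<in> W \<Longrightarrow> is_root (w \<alpha>)"
  using G.inv_closed[of w] by (auto simp: is_root_def W_nonzero conj_reflection')

lemma is_root_minus: "is_root \<alpha> \<Longrightarrow> is_root (- \<alpha>)"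
  by (simp add: is_root_def reflection_minus)

lemma regular_root: "is_root \<alpha> \<Longrightarrow> \<rho> \<bullet> \<alpha> \<noteq> 0"
  using regular by (simp add: is_root_def)

lemma reflection_rootE:
  assumes "t \<in> reflections W"
  obtains \<alpha> where "is_root \<alpha>" "t = reflection \<alpha>" "0 < \<rho> \<bullet> \<alpha>"
proof -
  obtain \<alpha> where a: "is_root \<alpha>" "t = reflection \<alpha>"
    using assms by (auto simp: reflections_def is_root_def)
  show ?thesis
  proof (cases "0 < \<rho> \<bullet> \<alpha>")
    case True
    with a that show ?thesis by blast
  next
    case False
    then have "0 < \<rho> \<bullet> (- \<alpha>)" using regular_root[OF a(1)] by simp
    moreover have "t = reflection (- \<alpha>)" using a by (simp add: reflection_minus)
    ultimately show ?thesis using that is_root_minus[OF a(1)] by blast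
  qed
qed

lemma reflections_conj_closed:
  assumes "t \<in> reflections W" "w \<in> W"
  shows "conj_by (map_group W) t w \<in> reflections W"
proof -
  let ?v = "inv\<^bsub>map_group W\<^esub> w"
  obtain \<alpha> where a: "is_root \<alpha>" "t = reflection \<alpha>" using assms reflection_rootE by metis
  have v: "?v \<in> W" using G.inv_closed[of w] assms by simp
  have "conj_by (map_group W) t w = reflection (?v \<alpha>)"
    using conj_reflection'[OF v, of \<alpha>] G.inv_inv[of w] assms a by (simp add: conj_by_def)
  with is_root_image[OF a(1) v] show ?thesis
    by (auto simp: is_root_def reflections_def)
qed

lemma prod_in_W: "set ts \<subseteq> W \<Longrightarrow> \<Pi>\<^sub>L ts \<in> W"
  using G.list_prod_closed by simp

lemma prod_append: "set ts \<subseteq> W \<Longrightarrow> set us \<subseteq> W \<Longrightarrow> \<Pi>\<^sub>L (ts @ us) = \<Pi>\<^sub>L ts \<circ> \<Pi>\<^sub>L us"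
  using G.list_prod_append by simp

text \<open>The height measures how close \<open>w \<rho>\<close> is to \<open>\<rho>\<close>. It plays the part of the length
  function: under multiplication by a reflection it falls exactly when the length rises.\<close>

definition height :: "('a \<Rightarrow> 'a) \<Rightarrow> real"
  where "height w = w \<rho> \<bullet> \<rho>"

lemma height_reflection:
  assumes "w \<in> W"
  shows "height (w \<circ> reflection \<alpha>) = height w - 2 * (\<rho> \<bullet> \<alpha>) / (\<alpha> \<bullet> \<alpha>) * (w \<alpha> \<bullet> \<rho>)"
  using orthogonal_transformation_W[OF assms]
  by (simp add: height_def reflection_alt orthogonal_transformation_def linear_diff linear_cmul
      inner_diff_left)

lemma height_reflection_less_iff:
  assumes "w \<in> W" "is_root \<alpha>" "0 < \<rho> \<bullet> \<alpha>"
  shows "height w < height (w \<circ> reflection \<alpha>) \<longleftrightarrow> \<rho> \<bullet> w \<alpha> < 0"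
proof -
  define k where "k = 2 * (\<rho> \<bullet> \<alpha>) / (\<alpha> \<bullet> \<alpha>)"
  have "0 < \<alpha> \<bullet> \<alpha>" using assms by (simp add: is_root_def)
  then have "0 < k" using assms by (simp add: k_def)
  moreover have "height (w \<circ> reflection \<alpha>) = height w - k * (\<rho> \<bullet> w \<alpha>)"
    using height_reflection[OF assms(1)] by (simp only: k_def inner_commute[of \<rho> "w \<alpha>"])
  ultimately show ?thesis by (simp add: mult_less_0_iff)
qed

lemma height_reflection_neq:
  assumes "w \<in> W" "t \<in> reflections W"
  shows "height (w \<circ> t) \<noteq> height w"
proof -
  obtain \<alpha> where a: "is_root \<alpha>" "t = reflection \<alpha>" using assms reflection_rootE by metis
  show ?thesis
    using regular_root[OF a(1)] regular_root[OF is_root_image[OF a(1) assms(1)]] a assms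
    by (simp add: height_reflection is_root_def inner_commute)
qed

text \<open>Both neighbours of the lowest point \<open>z = x \<circ> t\<close> arise from it by left multiplication with a
  reflection, and the hypotheses say that both of these reflections move \<open>z \<rho>\<close> towards \<open>\<rho>\<close>. Their products in the two orders, applied to \<open>z \<rho>\<close>, correspond to the
  middle points after the Hurwitz move at this place and after its inverse.\<close>

lemma height_dip:
  assumes x: "x \<in> W" and t: "t \<in> reflections W" "t' \<in> reflections W" "t \<noteq> t'"
    and less: "height (x \<circ> t) < height x" "height (x \<circ> t) < height (x \<circ> t \<circ> t')"
  shows "height (x \<circ> t) < height (x \<circ> t') \<or> height (x \<circ> t) < height (x \<circ> t \<circ> t' \<circ> t)"
proof -
  obtain \<alpha> where a: "is_root \<alpha>" "t = reflection \<alpha>" using t reflection_rootE by metis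
  obtain \<beta> where b: "is_root \<beta>" "t' = reflection \<beta>" using t reflection_rootE by metis
  define z where "z = x \<circ> t"
  have z: "z \<in> W" "z \<circ> t = x" using x t reflections_subset reflection_involution
    by (auto simp: z_def comp_assoc)
  have ra: "reflection (z \<alpha>) (z v) = z (t v)" and rb: "reflection (z \<beta>) (z v) = z (t' v)" for v
    using conj_reflection[OF z(1)] a b by (simp_all add: fun_eq_iff)
  have "inj z" using orthogonal_transformation_W[OF z(1)] orthogonal_transformation_inj by blast
  then have "reflection (z \<alpha>) \<noteq> reflection (z \<beta>)"
    using ra rb t(3) by (metis ext injD)
  moreover have "z \<rho> \<bullet> \<rho> < reflection (z \<alpha>) (z \<rho>) \<bullet> \<rho>"
    using less(1) z(2) unfolding ra by (auto simp: height_def simp flip: z_def)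
  moreover have "z \<rho> \<bullet> \<rho> < reflection (z \<beta>) (z \<rho>) \<bullet> \<rho>"
    using less(2) unfolding rb by (simp add: height_def flip: z_def)
  moreover have "z \<alpha> \<noteq> 0" "z \<beta> \<noteq> 0"
    using W_nonzero[OF z(1)] a b by (auto simp: is_root_def)
  ultimately have "z \<rho> \<bullet> \<rho> < reflection (z \<alpha>) (reflection (z \<beta>) (z \<rho>)) \<bullet> \<rho> \<or>
      z \<rho> \<bullet> \<rho> < reflection (z \<beta>) (reflection (z \<alpha>) (z \<rho>)) \<bullet> \<rho>"
    by (intro reflection_pair_toward)
  then have "height z < height (z \<circ> t \<circ> t') \<or> height z < height (z \<circ> t' \<circ> t)"
    unfolding ra rb by (simp add: height_def)
  then show ?thesis
    unfolding z(2) unfolding z_def .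
qed

fun path_height :: "('a \<Rightarrow> 'a) \<Rightarrow> ('a \<Rightarrow> 'a) list \<Rightarrow> real" where
  "path_height x [] = 0"
| "path_height x (t # ts) = height (x \<circ> t) + path_height (x \<circ> t) ts"

lemma path_height_append:
  "path_height x (us @ vs) = path_height x us + path_height (x \<circ> \<Pi>\<^sub>L us) vs"
  by (induction us arbitrary: x) (auto simp: comp_assoc)

lemma path_height_pair:
  "path_height id (zs @ [a, b] @ ys) =
    path_height id zs + height (\<Pi>\<^sub>L zs \<circ> a) + height (\<Pi>\<^sub>L zs \<circ> a \<circ> b) + path_height (\<Pi>\<^sub>L zs \<circ> a \<circ> b) ys"
  by (simp add: path_height_append)

lemma hurwitz_reflections:
  "ts \<sim>\<^sub>H us \<Longrightarrow> set ts \<subseteq> reflections W \<longleftrightarrow> set us \<subseteq> reflections W"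
  using reflections_subset reflections_conj_closed
  by (intro G.hurwitz_closed_under_conj) auto

lemma ex_maximal_path:
  assumes "set ts \<subseteq> reflections W"
  shows "\<exists>us. ts \<sim>\<^sub>H us \<and>
    (\<forall>vs. ts \<sim>\<^sub>H vs \<longrightarrow> path_height id vs \<le> path_height id us)"
proof -
  define orb where "orb = {us. ts \<sim>\<^sub>H us}"
  have "orb \<subseteq> {us. set us \<subseteq> W \<and> length us = length ts}"
    using assms hurwitz_reflections[of ts] reflections_subset G.hurwitz_length[of ts]
    by (fastforce simp: orb_def)
  then have fin: "finite (path_height id ` orb)"
    using finite_lists_length_eq[OF finite_W] by (blast intro: finite_subset finite_imageI)
  have "ts \<in> orb" by (simp add: orb_def G.hurwitz_refl)
  then have "Max (path_height id ` orb) \<in> path_height id ` orb"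
    using fin by (intro Max_in) auto
  then obtain us where us: "us \<in> orb" "path_height id us = Max (path_height id ` orb)" by auto
  then have "\<forall>vs\<in>orb. path_height id vs \<le> path_height id us"
    using fin by (auto intro: Max_ge)
  with us show ?thesis by (auto simp: orb_def)
qed

lemma hurwitz_swap_at:
  assumes "set (xs @ [a, b] @ ys) \<subseteq> W"
  shows "xs @ [a, b] @ ys \<sim>\<^sub>H xs @ [b, conj_by (map_group W) a b] @ ys"
  using assms by (intro G.hurwitz_append G.hurwitz_swap) auto

text \<open>Induction along the path: the first step falls because the identity is the highest element, and a rise
  right after a fall would be a dip, which a Hurwitz move or its inverse would lift, against the
  maximality. Only two equal neighbours escape this.\<close>

lemma maximal_path_descends:
  assumes us: "set us \<subseteq> reflections W"
    and max: "\<And>vs. us \<sim>\<^sub>H vs \<Longrightarrow> path_height id vs \<le> path_height id us"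
    and nopair: "\<And>xs t ys. us \<noteq> xs @ [t, t] @ ys"
    and "us = xs @ t # ys"
  shows "height (\<Pi>\<^sub>L xs \<circ> t) < height (\<Pi>\<^sub>L xs)"
  using assms(4)
proof (induction xs arbitrary: t ys rule: rev_induct)
  case Nil
  then obtain \<alpha> where a: "is_root \<alpha>" "t = reflection \<alpha>" "0 < \<rho> \<bullet> \<alpha>"
    using us reflection_rootE[of t] by auto
  have "\<not> height id < height (id \<circ> t)"
    using height_reflection_less_iff[of id \<alpha>] a by simp
  then have "height t < height id" using height_reflection_neq[of id t] us Nil by fastforce
  then show ?case by (simp only: G.list_prod_simps map_group_simps id_comp)
next
  case (snoc t0 zs)
  let ?x = "\<Pi>\<^sub>L zs"
  have eq: "us = zs @ [t0, t] @ ys" using snoc.prems by simp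
  have R: "t0 \<in> reflections W" "t \<in> reflections W" "set zs \<subseteq> W" "set ys \<subseteq> W" "t0 \<in> W" "t \<in> W"
    using us reflections_subset unfolding eq by auto
  have x: "?x \<in> W" using R prod_in_W by simp
  have "t0 \<noteq> t" using nopair[of zs t ys] eq by auto
  have IH: "height (?x \<circ> t0) < height ?x" by (rule snoc.IH) (simp add: eq)
  have p: "\<Pi>\<^sub>L (zs @ [t0]) = ?x \<circ> t0" using R by (simp add: prod_append)
  have inv: "t0 (t0 v) = v" "t (t v) = v" for v
    using reflection_involution[OF R(1)] reflection_involution[OF R(2)] by (simp_all add: fun_eq_iff)
  have c: "conj_by (map_group W) t0 t = t \<circ> t0 \<circ> t" "conj_by (map_group W) t t0 = t0 \<circ> t \<circ> t0"
    using R by (simp_all add: conj_by_def inv_reflection)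
  have cc: "conj_by (map_group W) (t0 \<circ> t \<circ> t0) t0 = t"
    unfolding conj_by_def map_group_simps inv_reflection[OF R(1)] by (rule ext) (simp add: inv)
  have "\<not> height (?x \<circ> t0) < height (?x \<circ> t0 \<circ> t)"
  proof
    assume less: "height (?x \<circ> t0) < height (?x \<circ> t0 \<circ> t)"
    from height_dip[OF x R(1,2) \<open>t0 \<noteq> t\<close> IH less] show False
    proof
      assume 1: "height (?x \<circ> t0) < height (?x \<circ> t)"
      have e: "?x \<circ> t \<circ> (t \<circ> t0 \<circ> t) = ?x \<circ> t0 \<circ> t"
        by (simp add: fun_eq_iff inv)
      have "path_height id (zs @ [t, t \<circ> t0 \<circ> t] @ ys) \<le> path_height id us"
        using hurwitz_swap_at[of zs t0 t ys] R unfolding c(1) by (intro max) (simp add: eq)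
      then show False using 1 unfolding eq path_height_pair e by linarith
    next
      assume 2: "height (?x \<circ> t0) < height (?x \<circ> t0 \<circ> t \<circ> t0)"
      have e: "?x \<circ> (t0 \<circ> t \<circ> t0) \<circ> t0 = ?x \<circ> t0 \<circ> t"
        by (simp add: fun_eq_iff inv)
      have "zs @ [t0 \<circ> t \<circ> t0, t0] @ ys \<sim>\<^sub>H us"
        using hurwitz_swap_at[of zs "t0 \<circ> t \<circ> t0" t0 ys] R unfolding cc by (simp add: eq)
      then have "path_height id (zs @ [t0 \<circ> t \<circ> t0, t0] @ ys) \<le> path_height id us"
        by (rule max[OF G.hurwitz_sym])
      then show False using 2 unfolding eq path_height_pair e by (simp add: comp_assoc)
    qed
  qed
  then show ?case
    unfolding p using height_reflection_neq[of "?x \<circ> t0" t] comp_closed[OF x R(5)] R(2) by linarith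
qed

text \<open>The alternative that drives both inductions below, on the length of a factorization.\<close>

lemma hurwitz_pair_or_descent:
  assumes ts: "set ts \<subseteq> reflections W" and "ts \<noteq> []"
  obtains (pair) t us where "ts \<sim>\<^sub>H t # t # us"
  | (descent) zs t where "ts \<sim>\<^sub>H zs @ [t]" "height (\<Pi>\<^sub>L ts) < height (\<Pi>\<^sub>L zs)"
proof -
  obtain us where us: "ts \<sim>\<^sub>H us" and max: "\<And>vs. ts \<sim>\<^sub>H vs \<Longrightarrow> path_height id vs \<le> path_height id us"
    using ex_maximal_path[OF ts] by blast
  have R: "set us \<subseteq> reflections W" using hurwitz_reflections[OF us] ts by simp
  show thesis
  proof (cases "\<exists>xs t ys. us = xs @ [t, t] @ ys")
    case True
    then obtain xs t ys where eq: "us = xs @ [t, t] @ ys" by blast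
    have "us \<sim>\<^sub>H t # t # xs @ ys"
      using G.hurwitz_pair_front[of t xs ys] R reflections_subset reflection_involution[of t]
      unfolding eq by auto
    with us show ?thesis using pair G.hurwitz_trans by blast
  next
    case False
    have "us \<noteq> []" using G.hurwitz_length[OF us] assms by auto
    then obtain zs t where eq: "us = zs @ [t]" by (metis rev_exhaust)
    have "height (\<Pi>\<^sub>L zs \<circ> t) < height (\<Pi>\<^sub>L zs)"
      using maximal_path_descends[OF R _ _ eq] max us False G.hurwitz_trans by blast
    moreover have "\<Pi>\<^sub>L ts = \<Pi>\<^sub>L zs \<circ> t"
      using G.hurwitz_list_prod[OF us] R reflections_subset eq prod_append[of zs "[t]"] by auto
    ultimately show ?thesis using descent us eq by simp
  qed
qed

text \<open>An equal pair can be cancelled, and a last step that falls in height makes a positive root negative.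
  So nothing but the empty product is left.\<close>

lemma reflection_product_positive_id:
  assumes "set ts \<subseteq> reflections W"
    and "\<And>\<alpha>. is_root \<alpha> \<Longrightarrow> 0 < \<rho> \<bullet> \<alpha> \<Longrightarrow> 0 < \<rho> \<bullet> \<Pi>\<^sub>L ts \<alpha>"
  shows "\<Pi>\<^sub>L ts = id"
  using assms
proof (induction "length ts" arbitrary: ts rule: less_induct)
  case less
  show ?case
  proof (cases "ts = []")
    case True
    then show ?thesis by simp
  next
    case False
    from less.prems(1) False show ?thesis
    proof (cases rule: hurwitz_pair_or_descent)
      case (pair t us)
      have R: "t \<in> reflections W" "set us \<subseteq> reflections W"
        using hurwitz_reflections[OF pair] less.prems(1) by auto
      have "\<Pi>\<^sub>L ts = \<Pi>\<^sub>L us"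
        using G.hurwitz_list_prod[OF pair] reflection_involution[OF R(1)]
        by (simp flip: comp_assoc)
      moreover have "length us < length ts" using G.hurwitz_length[OF pair] by simp
      ultimately show ?thesis using less R by metis
    next
      case (descent zs t)
      have R: "t \<in> reflections W" "set zs \<subseteq> reflections W" "set ts \<subseteq> W"
        using hurwitz_reflections[OF descent(1)] less.prems(1) reflections_subset by auto
      obtain \<alpha> where a: "is_root \<alpha>" "t = reflection \<alpha>" "0 < \<rho> \<bullet> \<alpha>"
        using R reflection_rootE[of t] by auto
      have "\<Pi>\<^sub>L ts = \<Pi>\<^sub>L zs \<circ> t"
        using G.hurwitz_list_prod[OF descent(1)] R reflections_subset prod_append[of zs "[t]"] by auto
      then have "\<Pi>\<^sub>L ts \<circ> t = \<Pi>\<^sub>L zs" using reflection_involution[OF R(1)]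
        by (simp add: comp_assoc)
      then have "\<rho> \<bullet> \<Pi>\<^sub>L ts \<alpha> < 0"
        using height_reflection_less_iff[of "\<Pi>\<^sub>L ts" \<alpha>] a descent prod_in_W[OF R(3)] by simp
      with less.prems(2)[of \<alpha>] a show ?thesis by simp
    qed
  qed
qed

lemma generate_involutions_list:
  assumes "w \<in> generate (map_group W) S" "S \<subseteq> reflections W"
  shows "\<exists>ts. set ts \<subseteq> S \<and> \<Pi>\<^sub>L ts = w"
  using assms(1)
proof induction
  case one
  show ?case by (intro exI[of _ "[]"]) simp
next
  case (incl s)
  then show ?case by (intro exI[of _ "[s]"]) simp
next
  case (inv s)
  then show ?case using assms(2) inv_reflection[of s] by (intro exI[of _ "[s]"]) auto
next
  case (eng g h)
  then obtain ts us where "set ts \<subseteq> S" "\<Pi>\<^sub>L ts = g" "set us \<subseteq> S" "\<Pi>\<^sub>L us = h" by blast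
  then show ?case using assms(2) reflections_subset
    by (intro exI[of _ "ts @ us"]) (auto simp: prod_append)
qed

text \<open>Such an element fixes the chamber of \<open>\<rho>\<close>; so this says that \<open>W\<close> acts freely on the chambers.\<close>

lemma positive_id:
  assumes "w \<in> W" "\<And>\<alpha>. is_root \<alpha> \<Longrightarrow> 0 < \<rho> \<bullet> \<alpha> \<Longrightarrow> 0 < \<rho> \<bullet> w \<alpha>"
  shows "w = id"
proof -
  obtain ts where "set ts \<subseteq> reflections W" "\<Pi>\<^sub>L ts = w"
    using generate_involutions_list[of w "reflections W"] assms generate_reflections by auto
  then show ?thesis using reflection_product_positive_id[of ts] assms by simp
qed

end

section \<open>Simple systems\<close>

text \<open>The properties of simple roots on which the argument rests. The last one says that there are
  enough of them: they cut out the same closed chamber as all positive roots.\<close>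

locale simple_system = regular_point +
  fixes \<Delta> :: "'a set"
  assumes simple_root: "\<alpha> \<in> \<Delta> \<Longrightarrow> is_root \<alpha>"
    and simple_positive: "\<alpha> \<in> \<Delta> \<Longrightarrow> 0 < \<rho> \<bullet> \<alpha>"
    and simple_reflection_positive: "\<alpha> \<in> \<Delta> \<Longrightarrow> is_root \<beta> \<Longrightarrow> 0 < \<rho> \<bullet> \<beta> \<Longrightarrow>
      reflection \<beta> \<noteq> reflection \<alpha> \<Longrightarrow> 0 < \<rho> \<bullet> reflection \<alpha> \<beta>"
    and simple_obtuse: "\<alpha> \<in> \<Delta> \<Longrightarrow> \<beta> \<in> \<Delta> \<Longrightarrow> \<alpha> \<noteq> \<beta> \<Longrightarrow> \<alpha> \<bullet> \<beta> \<le> 0"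
    and dominant: "(\<And>\<alpha>. \<alpha> \<in> \<Delta> \<Longrightarrow> 0 \<le> v \<bullet> \<alpha>) \<Longrightarrow> is_root \<beta> \<Longrightarrow> 0 < \<rho> \<bullet> \<beta> \<Longrightarrow> 0 \<le> v \<bullet> \<beta>"
begin

lemma simple_reflections: "\<alpha> \<in> \<Delta> \<Longrightarrow> reflection \<alpha> \<in> reflections W"
  using simple_root by (auto simp: is_root_def reflections_def)

lemma simple_in_W: "set \<alpha>s \<subseteq> \<Delta> \<Longrightarrow> set (map reflection \<alpha>s) \<subseteq> W"
  using simple_reflections reflections_subset by auto

text \<open>Multiply \<open>w\<close> on the left by the element \<open>g\<close> of the generated subgroup that makes the height maximal.
  Then no simple reflection brings \<open>g w \<rho>\<close> closer to \<open>\<rho>\<close>, so \<open>g w \<rho>\<close> lies in the chamber of \<open>\<rho>\<close>. Hence the inverse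
  of \<open>g w\<close> keeps positive roots positive and is trivial.\<close>

lemma generate_simple: "generate (map_group W) (reflection ` \<Delta>) = W"
proof
  let ?S = "generate (map_group W) (reflection ` \<Delta>)"
  have sub: "reflection ` \<Delta> \<subseteq> carrier (map_group W)"
    using simple_reflections reflections_subset by auto
  then show "?S \<subseteq> W" using G.generate_incl by simp
  show "W \<subseteq> ?S"
  proof
    fix w assume w: "w \<in> W"
    have fin: "finite ((\<lambda>g. height (g \<circ> w)) ` ?S)"
      using \<open>?S \<subseteq> W\<close> finite_W finite_subset by blast
    have "Max ((\<lambda>g. height (g \<circ> w)) ` ?S) \<in> (\<lambda>g. height (g \<circ> w)) ` ?S"
      using generate.one[of "map_group W" "reflection ` \<Delta>"] fin by (intro Max_in) auto
    then obtain g where g: "g \<in> ?S" "Max ((\<lambda>g. height (g \<circ> w)) ` ?S) = height (g \<circ> w)" by auto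
    have max: "height (h \<circ> w) \<le> height (g \<circ> w)" if "h \<in> ?S" for h
      using that fin unfolding g(2)[symmetric] by (intro Max_ge) auto
    define h where "h = g \<circ> w"
    have h: "h \<in> W" using g w \<open>?S \<subseteq> W\<close> by (auto simp: h_def)
    let ?k = "inv\<^bsub>map_group W\<^esub> h"
    have k: "?k \<in> W" using G.inv_closed[of h] h by simp
    have dom: "0 \<le> h \<rho> \<bullet> \<alpha>" if a: "\<alpha> \<in> \<Delta>" for \<alpha>
    proof -
      have "reflection \<alpha> \<circ> g \<in> ?S"
        using generate.eng[OF generate.incl[of "reflection \<alpha>"] g(1)] a by simp
      then have "reflection \<alpha> (h \<rho>) \<bullet> \<rho> \<le> h \<rho> \<bullet> \<rho>"
        using max by (fastforce simp: height_def h_def)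
      then have "0 \<le> 2 * (h \<rho> \<bullet> \<alpha>) * (\<alpha> \<bullet> \<rho>) / (\<alpha> \<bullet> \<alpha>)"
        by (simp add: reflection_alt inner_diff_left)
      moreover have "0 < \<alpha> \<bullet> \<rho>" "0 < \<alpha> \<bullet> \<alpha>"
        using simple_positive[OF a] by (auto simp: inner_commute)
      ultimately show ?thesis by (simp add: zero_le_divide_iff zero_le_mult_iff)
    qed
    have "?k = id"
    proof (rule positive_id[OF k])
      fix \<beta> assume b: "is_root \<beta>" "0 < \<rho> \<bullet> \<beta>"
      have "\<rho> \<bullet> ?k \<beta> = h \<rho> \<bullet> \<beta>" using inner_inv[OF h] by simp
      moreover have "0 \<le> h \<rho> \<bullet> \<beta>" using dominant[OF dom b] .
      moreover have "\<rho> \<bullet> ?k \<beta> \<noteq> 0" using regular_root[OF is_root_image[OF b(1) k]] .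
      ultimately show "0 < \<rho> \<bullet> ?k \<beta>" by simp
    qed
    then have "h = id" using G.r_inv[of h] h by simp
    then have "g \<circ> w = id" by (simp add: h_def)
    moreover have gW: "g \<in> W" using g(1) \<open>?S \<subseteq> W\<close> by auto
    ultimately have "w = inv\<^bsub>map_group W\<^esub> g"
      using G.inv_equality[of w g] G.inv_comm[of g w] w by simp
    then show "w \<in> ?S" using G.generate_m_inv_closed[OF sub g(1)] by simp
  qed
qed

text \<open>Apply the simple reflections one after the other to \<open>\<beta>\<close>, beginning with the last. At the first sign
  change the simple reflection meets a positive root that it makes negative, which can only be its own.\<close>

lemma strong_exchange:
  assumes "set \<alpha>s \<subseteq> \<Delta>" and b: "is_root \<beta>" "0 < \<rho> \<bullet> \<beta>"
    and "\<rho> \<bullet> \<Pi>\<^sub>L (map reflection \<alpha>s) \<beta> < 0"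
  shows "\<exists>as \<alpha> bs. \<alpha>s = as @ \<alpha> # bs \<and>
    reflection \<beta> = conj_by (map_group W) (reflection \<alpha>) (\<Pi>\<^sub>L (map reflection bs))"
  using assms(1,4)
proof (induction \<alpha>s)
  case Nil
  then show ?case using b by simp
next
  case (Cons \<alpha> \<alpha>s)
  let ?w = "\<Pi>\<^sub>L (map reflection \<alpha>s)"
  have w: "?w \<in> W" using Cons.prems simple_in_W by (intro prod_in_W) auto
  show ?case
  proof (cases "\<rho> \<bullet> ?w \<beta> < 0")
    case True
    then obtain as \<alpha>' bs where "\<alpha>s = as @ \<alpha>' # bs"
      "reflection \<beta> = conj_by (map_group W) (reflection \<alpha>') (\<Pi>\<^sub>L (map reflection bs))"
      using Cons by auto
    then show ?thesis by (metis append_Cons)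
  next
    case False
    have r: "is_root (?w \<beta>)" using is_root_image b w by simp
    have "0 < \<rho> \<bullet> ?w \<beta>" using False regular_root[OF r] by simp
    moreover have "\<not> 0 < \<rho> \<bullet> reflection \<alpha> (?w \<beta>)" using Cons.prems by simp
    ultimately have eq: "reflection \<alpha> = reflection (?w \<beta>)"
      using simple_reflection_positive[of \<alpha>, OF _ r] Cons.prems by fastforce
    have "inv\<^bsub>map_group W\<^esub> ?w \<circ> ?w = id" using G.l_inv[of ?w] w by simp
    then have "reflection \<beta> = conj_by (map_group W) (reflection \<alpha>) ?w"
      using conj_reflection[OF w, of \<beta>] eq
      by (simp add: conj_by_def comp_assoc) (simp flip: comp_assoc)
    then show ?thesis by (intro exI[of _ "[]"] exI[of _ \<alpha>] exI[of _ \<alpha>s]) simp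
  qed
qed

text \<open>Each further reflection subtracts from the moved point a positive multiple of a new simple root.
  By obtuseness this only increases the products with the simple roots not yet used, so the next
  multiple is positive again.\<close>

lemma simple_product_displacement:
  assumes "set \<alpha>s \<subseteq> \<Delta>" "distinct \<alpha>s"
  defines "x \<equiv> \<Pi>\<^sub>L (map reflection \<alpha>s) \<rho>"
  shows "(\<forall>\<gamma>\<in>\<Delta> - set \<alpha>s. \<rho> \<bullet> \<gamma> \<le> x \<bullet> \<gamma>) \<and> x \<bullet> \<rho> \<le> \<rho> \<bullet> \<rho> \<and> (\<alpha>s \<noteq> [] \<longrightarrow> x \<bullet> \<rho> < \<rho> \<bullet> \<rho>)"
  using assms(1,2) unfolding x_def
proof (induction \<alpha>s)
  case Nil
  then show ?case by simp
next
  case (Cons \<alpha> \<alpha>s)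
  define y where "y = \<Pi>\<^sub>L (map reflection \<alpha>s) \<rho>"
  define k where "k = 2 * (y \<bullet> \<alpha>) / (\<alpha> \<bullet> \<alpha>)"
  have a: "\<alpha> \<in> \<Delta>" "\<alpha> \<notin> set \<alpha>s" using Cons.prems by auto
  have IH: "\<forall>\<gamma>\<in>\<Delta> - set \<alpha>s. \<rho> \<bullet> \<gamma> \<le> y \<bullet> \<gamma>" "y \<bullet> \<rho> \<le> \<rho> \<bullet> \<rho>"
    using Cons by (auto simp: y_def)
  have "0 < y \<bullet> \<alpha>" using IH(1) a simple_positive[of \<alpha>] by force
  then have k: "0 < k" using simple_root[OF a(1)] by (simp add: k_def is_root_def)
  have x: "\<Pi>\<^sub>L (map reflection (\<alpha> # \<alpha>s)) \<rho> = y - k *\<^sub>R \<alpha>"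
    by (simp add: y_def k_def reflection_alt)
  have 1: "\<rho> \<bullet> \<gamma> \<le> (y - k *\<^sub>R \<alpha>) \<bullet> \<gamma>" if "\<gamma> \<in> \<Delta> - set (\<alpha> # \<alpha>s)" for \<gamma>
  proof -
    have "k * (\<alpha> \<bullet> \<gamma>) \<le> 0" using simple_obtuse[of \<alpha> \<gamma>] that a k by (auto simp: mult_le_0_iff)
    moreover have "\<rho> \<bullet> \<gamma> \<le> y \<bullet> \<gamma>" using IH(1) that by auto
    ultimately show ?thesis by (simp add: inner_diff_left)
  qed
  have "0 < k * (\<alpha> \<bullet> \<rho>)" using k simple_positive[OF a(1)] by (simp add: inner_commute)
  then have "(y - k *\<^sub>R \<alpha>) \<bullet> \<rho> < \<rho> \<bullet> \<rho>" using IH(2) by (simp add: inner_diff_left)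
  with 1 show ?case unfolding x by auto
qed

lemma simple_product_ne_id:
  assumes "set \<alpha>s \<subseteq> \<Delta>" "distinct \<alpha>s" "\<Pi>\<^sub>L (map reflection \<alpha>s) = id"
  shows "\<alpha>s = []"
  using simple_product_displacement[OF assms(1,2)] assms(3) by auto

text \<open>Induction on the length. An equal pair goes to the front and the rest is a shorter factorization of
  the same element. If the last step falls in height, then by the exchange property the last entry \<open>t\<close>
  is the conjugate that arises when some simple reflection of the product is moved to the end; the
  other entries of both lists then have the same product, and the induction applies to the product with
  that simple reflection omitted.\<close>

lemma hurwitz_normal_form:
  assumes "set ts \<subseteq> reflections W" "set \<alpha>s \<subseteq> \<Delta>" "distinct \<alpha>s"
    "\<Pi>\<^sub>L ts = \<Pi>\<^sub>L (map reflection \<alpha>s)"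
  shows "\<exists>rs. set rs \<subseteq> reflections W \<and> ts \<sim>\<^sub>H doubled rs @ map reflection \<alpha>s"
  using assms
proof (induction "length ts" arbitrary: ts \<alpha>s rule: less_induct)
  case less
  show ?case
  proof (cases "ts = []")
    case True
    then have "\<alpha>s = []" using simple_product_ne_id less.prems by simp
    with True show ?thesis by (intro exI[of _ "[]"]) (simp add: G.hurwitz_refl)
  next
    case False
    from less.prems(1) False show ?thesis
    proof (cases rule: hurwitz_pair_or_descent)
      case (pair t us)
      have R: "t \<in> reflections W" "set us \<subseteq> reflections W" "t \<in> W"
        using hurwitz_reflections[OF pair] less.prems(1) reflections_subset by auto
      have "\<Pi>\<^sub>L ts = \<Pi>\<^sub>L us"
        using G.hurwitz_list_prod[OF pair] reflection_involution[OF R(1)]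
        by (simp flip: comp_assoc)
      moreover have "length us < length ts" using G.hurwitz_length[OF pair] by simp
      ultimately obtain rs where rs: "set rs \<subseteq> reflections W"
        "us \<sim>\<^sub>H doubled rs @ map reflection \<alpha>s"
        using less.hyps[of us \<alpha>s] R less.prems by auto
      then have "t # t # us \<sim>\<^sub>H t # t # doubled rs @ map reflection \<alpha>s"
        using G.hurwitz_append[OF rs(2), of "[t, t]" "[]"] R by simp
      with pair rs R show ?thesis
        by (intro exI[of _ "t # rs"]) (auto intro: G.hurwitz_trans)
    next
      case (descent zs t)
      have R: "t \<in> reflections W" "set zs \<subseteq> reflections W" "set zs \<subseteq> W" "t \<in> W"
        using hurwitz_reflections[OF descent(1)] less.prems(1) reflections_subset by auto
      obtain \<beta> where b: "is_root \<beta>" "t = reflection \<beta>" "0 < \<rho> \<bullet> \<beta>"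
        using R reflection_rootE[of t] by auto
      let ?c = "\<Pi>\<^sub>L (map reflection \<alpha>s)"
      have c: "?c \<in> W" using less.prems simple_in_W prod_in_W by blast
      have "?c = \<Pi>\<^sub>L zs \<circ> t"
        using G.hurwitz_list_prod[OF descent(1)] less.prems(4) R prod_append[of zs "[t]"] by simp
      then have ct: "?c \<circ> t = \<Pi>\<^sub>L zs" using reflection_involution[OF R(1)]
        by (simp add: comp_assoc)
      then have "\<rho> \<bullet> ?c \<beta> < 0"
        using height_reflection_less_iff[OF c b(1,3)] b descent(2) less.prems(4) by simp
      from strong_exchange[OF less.prems(2) b(1,3) this]
      obtain as \<alpha> bs where eq: "\<alpha>s = as @ \<alpha> # bs"
        and t: "t = conj_by (map_group W) (reflection \<alpha>) (\<Pi>\<^sub>L (map reflection bs))"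
        using b(2) by auto
      let ?a = "map reflection as" and ?b = "map reflection bs"
      have S: "set ?a \<subseteq> W" "set ?b \<subseteq> W" "reflection \<alpha> \<in> W" "set as \<subseteq> \<Delta>" "set bs \<subseteq> \<Delta>"
        using simple_in_W[OF less.prems(2)] less.prems(2) unfolding eq by auto
      have move: "reflection \<alpha> # ?b \<sim>\<^sub>H ?b @ [t]"
        unfolding t using S by (intro G.hurwitz_move_to_end) auto
      have tail: "map reflection \<alpha>s \<sim>\<^sub>H (?a @ ?b) @ [t]"
        using G.hurwitz_append[OF move, of ?a "[]"] S by (simp add: eq)
      have "?c = \<Pi>\<^sub>L (?a @ ?b) \<circ> t"
        using G.hurwitz_list_prod[OF tail] S R prod_append[of "?a @ ?b" "[t]"] by simp
      then have "\<Pi>\<^sub>L zs = \<Pi>\<^sub>L (map reflection (as @ bs))"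
        using ct reflection_involution[OF R(1)] by (simp add: comp_assoc)
      moreover have "length zs < length ts" using G.hurwitz_length[OF descent(1)] by simp
      ultimately obtain rs where rs: "set rs \<subseteq> reflections W"
        "zs \<sim>\<^sub>H doubled rs @ map reflection (as @ bs)"
        using less.hyps[of zs "as @ bs"] R S less.prems(3) eq by auto
      have "ts \<sim>\<^sub>H (doubled rs @ ?a @ ?b) @ [t]"
        using G.hurwitz_trans[OF descent(1)] G.hurwitz_append[OF rs(2), of "[]" "[t]"] R by simp
      moreover have "doubled rs @ map reflection \<alpha>s \<sim>\<^sub>H doubled rs @ (?a @ ?b) @ [t]"
        using G.hurwitz_append[OF tail, of "doubled rs" "[]"] rs(1) reflections_subset by auto
      ultimately have "ts \<sim>\<^sub>H doubled rs @ map reflection \<alpha>s"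
        by (metis G.hurwitz_sym G.hurwitz_trans append.assoc)
      with rs show ?thesis by blast
    qed
  qed
qed

text \<open>In the normal forms the tails agree, so equal multisets of classes leave equal multisets for the
  doubled parts, and multisets can be halved.\<close>

lemma hurwitz_iff_conj_classes:
  assumes \<alpha>s: "distinct \<alpha>s" "set \<alpha>s = \<Delta>"
    and ts: "set ts \<subseteq> reflections W" "\<Pi>\<^sub>L ts = \<Pi>\<^sub>L (map reflection \<alpha>s)"
    and ts': "set ts' \<subseteq> reflections W" "\<Pi>\<^sub>L ts' = \<Pi>\<^sub>L (map reflection \<alpha>s)"
  shows "ts \<sim>\<^sub>H ts' \<longleftrightarrow>
    image_mset (conj_class (map_group W)) (mset ts) = image_mset (conj_class (map_group W)) (mset ts')"
    (is "_ \<longleftrightarrow> ?cl ts = ?cl ts'")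
proof
  assume "ts \<sim>\<^sub>H ts'"
  then show "?cl ts = ?cl ts'" by (rule G.hurwitz_conj_classes)
next
  assume cl: "?cl ts = ?cl ts'"
  let ?ss = "map reflection \<alpha>s"
  obtain rs where rs: "set rs \<subseteq> reflections W" "ts \<sim>\<^sub>H doubled rs @ ?ss"
    using hurwitz_normal_form[OF ts(1) _ \<alpha>s(1) ts(2)] \<alpha>s(2) by auto
  obtain rs' where rs': "set rs' \<subseteq> reflections W" "ts' \<sim>\<^sub>H doubled rs' @ ?ss"
    using hurwitz_normal_form[OF ts'(1) _ \<alpha>s(1) ts'(2)] \<alpha>s(2) by auto
  have "?cl (doubled rs @ ?ss) = ?cl (doubled rs' @ ?ss)"
    using cl G.hurwitz_conj_classes[OF rs(2)] G.hurwitz_conj_classes[OF rs'(2)] by simp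
  then have double: "?cl rs + ?cl rs = ?cl rs' + ?cl rs'" by simp
  have "?cl rs = ?cl rs'"
  proof (rule multiset_eqI)
    fix C
    have "count (?cl rs + ?cl rs) C = count (?cl rs' + ?cl rs') C" using double by simp
    then show "count (?cl rs) C = count (?cl rs') C" by simp
  qed
  moreover have "generate (map_group W) (set ?ss) = W" "set ?ss \<subseteq> W"
    using generate_simple \<alpha>s(2) simple_in_W[of \<alpha>s] by simp_all
  moreover have "set rs \<subseteq> {t \<in> W. t \<circ> t = id}" "set rs' \<subseteq> {t \<in> W. t \<circ> t = id}"
    using rs(1) rs'(1) reflections_subset reflection_involution by auto
  ultimately have "doubled rs @ ?ss \<sim>\<^sub>H doubled rs' @ ?ss"
    by (intro G.hurwitz_doubled) simp_all
  with rs(2) rs'(2) show "ts \<sim>\<^sub>H ts'"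
    using G.hurwitz_trans G.hurwitz_sym by blast
qed

end

section \<open>Walls of Weyl chambers\<close>

text \<open>A reflecting hyperplane is determined by its reflection, as the set of fixed points.\<close>

lemma finite_reflecting_hyperplanes:
  assumes "finite W"
  shows "finite (reflecting_hyperplanes W)"
proof (rule finite_subset)
  show "reflecting_hyperplanes W \<subseteq> (\<lambda>w. {v. w v = v}) ` W"
    by (auto simp: reflecting_hyperplanes_def hyperplane_eq_fixed)
qed (use assms in simp)

locale chamber =
  fixes W :: "('a::euclidean_space \<Rightarrow> 'a) set" and F :: "'a set" and \<rho> :: 'a
  assumes reflection_group: "finite_reflection_group W"
    and chamber: "weyl_chamber W F"
    and base_point: "\<rho> \<in> F"
begin

lemma finite_W: "finite W"
  using reflection_group by (simp add: finite_reflection_group_def)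

definition positive_roots :: "'a set"
  where "positive_roots = {\<alpha>. \<alpha> \<noteq> 0 \<and> reflection \<alpha> \<in> W \<and> 0 < \<rho> \<bullet> \<alpha>}"

lemma chamber_regular:
  assumes "v \<in> F" "\<alpha> \<noteq> 0" "reflection \<alpha> \<in> W"
  shows "v \<bullet> \<alpha> \<noteq> 0"
proof
  assume "v \<bullet> \<alpha> = 0"
  then have "v \<in> \<Union>(reflecting_hyperplanes W)"
    using assms by (auto simp: reflecting_hyperplanes_def hyperplane_def)
  then show False
    using assms chamber in_components_subset[of F] by (auto simp: weyl_chamber_def)
qed

lemma chamber_positive:
  assumes "v \<in> F" "\<alpha> \<in> positive_roots"
  shows "0 < v \<bullet> \<alpha>"
proof (rule ccontr)
  assume "\<not> 0 < v \<bullet> \<alpha>"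
  moreover have "connected F" using chamber in_components_connected by (auto simp: weyl_chamber_def)
  ultimately obtain z where "z \<in> F" "\<alpha> \<bullet> z = 0"
    using connected_ivt_hyperplane[of F v \<rho> \<alpha> 0] assms base_point
    by (auto simp: positive_roots_def inner_commute)
  then show False using chamber_regular[of z \<alpha>] assms by (auto simp: positive_roots_def inner_commute)
qed

lemma positive_or_negative:
  assumes "\<alpha> \<noteq> 0" "reflection \<alpha> \<in> W"
  shows "\<alpha> \<in> positive_roots \<or> - \<alpha> \<in> positive_roots"
  using chamber_regular[OF base_point assms] assms
  by (auto simp: positive_roots_def reflection_minus)

text \<open>The right-hand side is convex, hence connected, and it avoids all reflecting hyperplanes.\<close>

lemma chamber_eq: "F = {v. \<forall>\<alpha>\<in>positive_roots. 0 < v \<bullet> \<alpha>}"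
proof
  show "F \<subseteq> {v. \<forall>\<alpha>\<in>positive_roots. 0 < v \<bullet> \<alpha>}" using chamber_positive by blast
  let ?C = "{v. \<forall>\<alpha>\<in>positive_roots. 0 < v \<bullet> \<alpha>}"
  have C: "?C = (\<Inter>\<alpha>\<in>positive_roots. {v. \<alpha> \<bullet> v > 0})" by (auto simp: inner_commute)
  have "convex ?C" unfolding C by (intro convex_INT convex_halfspace_gt)
  then have "connected ?C" by (rule convex_connected)
  moreover have "?C \<subseteq> - \<Union>(reflecting_hyperplanes W)"
  proof (intro subsetI ComplI, elim UnionE)
    fix v H assume v: "v \<in> ?C" "v \<in> H" "H \<in> reflecting_hyperplanes W"
    then obtain \<alpha> where a: "\<alpha> \<noteq> 0" "reflection \<alpha> \<in> W" "v \<bullet> \<alpha> = 0"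
      unfolding reflecting_hyperplanes_def hyperplane_def by blast
    have "0 < v \<bullet> \<alpha> \<or> 0 < v \<bullet> (- \<alpha>)"
      using positive_or_negative[OF a(1,2)] v(1) by blast
    then show False using a(3) by simp
  qed
  moreover have "\<rho> \<in> F \<inter> ?C" using base_point by (simp add: positive_roots_def)
  then have "F \<inter> ?C \<noteq> {}" by blast
  ultimately show "?C \<subseteq> F"
    using chamber unfolding weyl_chamber_def by (rule components_maximal[rotated])
qed

text \<open>Any \<open>v\<close> of the right-hand side is the limit of the points \<open>v + \<rho> / (n + 1)\<close> of the open chamber.\<close>

lemma closure_chamber: "closure F = {v. \<forall>\<alpha>\<in>positive_roots. 0 \<le> v \<bullet> \<alpha>}"
proof
  have C: "{v. \<forall>\<alpha>\<in>positive_roots. 0 \<le> v \<bullet> \<alpha>} = (\<Inter>\<alpha>\<in>positive_roots. {v. \<alpha> \<bullet> v \<ge> 0})"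
    by (auto simp: inner_commute)
  have "closed {v. \<forall>\<alpha>\<in>positive_roots. 0 \<le> v \<bullet> \<alpha>}"
    unfolding C by (intro closed_INT ballI closed_halfspace_ge)
  then show "closure F \<subseteq> {v. \<forall>\<alpha>\<in>positive_roots. 0 \<le> v \<bullet> \<alpha>}"
    by (intro closure_minimal) (force dest: chamber_positive)
next
  show "{v. \<forall>\<alpha>\<in>positive_roots. 0 \<le> v \<bullet> \<alpha>} \<subseteq> closure F"
  proof clarify
    fix v assume v: "\<forall>\<alpha>\<in>positive_roots. 0 \<le> v \<bullet> \<alpha>"
    define u where "u n = v + (1 / Suc n) *\<^sub>R \<rho>" for n
    have "u n \<in> F" for n
    proof -
      have "0 < u n \<bullet> \<alpha>" if "\<alpha> \<in> positive_roots" for \<alpha>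
        unfolding u_def inner_add_left inner_scaleR_left
        using v that by (intro add_nonneg_pos mult_pos_pos) (auto simp: positive_roots_def)
      then show ?thesis by (subst chamber_eq) blast
    qed
    moreover have "u \<longlonglongrightarrow> v + 0 *\<^sub>R \<rho>"
      unfolding u_def by (intro tendsto_intros LIMSEQ_Suc[OF lim_1_over_n])
    ultimately show "v \<in> closure F" unfolding closure_sequential by auto
  qed
qed

lemma chamber_nonempty: "F \<noteq> {}"
  using base_point by auto

lemma chamber_open: "open F"
proof -
  have "closed (hyperplane \<alpha>)" for \<alpha> :: 'a
    using closed_hyperplane[of \<alpha> 0] by (simp add: hyperplane_def inner_commute)
  then have "closed (\<Union>(reflecting_hyperplanes W))"
    using finite_reflecting_hyperplanes[OF finite_W]
    by (intro closed_Union) (auto simp: reflecting_hyperplanes_def)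
  then show ?thesis
    using chamber open_components by (metis open_Compl weyl_chamber_def)
qed

lemma affine_hull_closure_chamber: "affine hull (closure F) = UNIV"
  using affine_hull_open[OF chamber_open chamber_nonempty] by simp

text \<open>Otherwise the facet on the hyperplane of \<open>\<alpha>\<close> would lie in the hyperplane of \<open>\<beta>\<close> too. A facet of the
  full-dimensional closed chamber spans the hyperplane that contains it, so the two would be equal.\<close>

lemma wall_point:
  assumes "\<alpha> \<in> positive_roots" "hyperplane \<alpha> \<in> walls W F"
    and "\<beta> \<in> positive_roots" "hyperplane \<alpha> \<noteq> hyperplane \<beta>"
  shows "\<exists>p\<in>closure F. p \<bullet> \<alpha> = 0 \<and> 0 < p \<bullet> \<beta>"
proof (rule ccontr)
  assume neg: "\<not> ?thesis"
  let ?C = "hyperplane \<alpha> \<inter> closure F"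
  have *: "\<alpha> \<noteq> 0" "\<beta> \<noteq> 0" using assms by (auto simp: positive_roots_def)
  have "?C facet_of closure F" using assms by (simp add: walls_def)
  then have C: "?C \<noteq> {}" "aff_dim ?C = aff_dim (closure F) - 1" by (auto simp: facet_of_def)
  have dim: "aff_dim (closure F) = DIM('a)"
    using aff_dim_affine_hull[of "closure F"] unfolding affine_hull_closure_chamber by simp
  have sub: "?C \<subseteq> hyperplane \<beta>"
  proof
    fix p assume p: "p \<in> ?C"
    then have "0 \<le> p \<bullet> \<beta>" using assms closure_chamber by auto
    moreover have "\<not> 0 < p \<bullet> \<beta>" using p neg by (auto simp: hyperplane_def)
    ultimately show "p \<in> hyperplane \<beta>" by (simp add: hyperplane_def)
  qed
  have eq: "affine hull ?C = hyperplane \<gamma>" if "?C \<subseteq> hyperplane \<gamma>" "\<gamma> \<noteq> 0" for \<gamma>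
  proof (rule affine_dim_equal)
    have h: "hyperplane \<gamma> = {v. \<gamma> \<bullet> v = 0}" by (auto simp: hyperplane_def inner_commute)
    show "affine (hyperplane \<gamma>)" unfolding h by (rule affine_hyperplane)
    then show "affine hull ?C \<subseteq> hyperplane \<gamma>" using that by (simp add: hull_minimal)
    show "aff_dim (affine hull ?C) = aff_dim (hyperplane \<gamma>)"
      using C(2) that(2) dim unfolding h aff_dim_affine_hull by simp
  qed (use C in auto)
  show False
    using eq[of \<alpha>] eq[OF sub] * assms(4) by auto
qed

lemma positive_roots_same_hyperplane:
  assumes "\<alpha> \<in> positive_roots" "\<beta> \<in> positive_roots" "hyperplane \<alpha> = hyperplane \<beta>"
  shows "\<exists>k>0. \<beta> = k *\<^sub>R \<alpha>"
proof -
  obtain k where k: "\<beta> = k *\<^sub>R \<alpha>"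
    using assms hyperplane_eq_iff[of \<alpha> \<beta>] by (auto simp: positive_roots_def)
  with assms have "0 < k" by (auto simp: positive_roots_def zero_less_mult_iff)
  with k show ?thesis by blast
qed

text \<open>The closed chamber is the intersection of finitely many half-spaces. Those of a minimal subfamily
  with the same intersection are exactly the ones that touch it in facets, by the description of the
  facets of a polyhedron, so they belong to walls.\<close>

lemma walls_dominant:
  assumes v: "\<And>\<alpha>. \<alpha> \<in> positive_roots \<Longrightarrow> hyperplane \<alpha> \<in> walls W F \<Longrightarrow> 0 \<le> v \<bullet> \<alpha>"
  shows "v \<in> closure F"
proof -
  define half where "half \<alpha> = {x. 0 \<le> x \<bullet> \<alpha>}" for \<alpha> :: 'a
  define normal where "normal h = (SOME \<alpha>. \<alpha> \<in> positive_roots \<and> half \<alpha> = h)" for h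
  have normal: "normal h \<in> positive_roots \<and> half (normal h) = h" if "h \<in> half ` positive_roots" for h
    unfolding normal_def by (rule someI_ex) (use that in auto)
  have half_eq: "half \<alpha> = half \<beta>"
    if ab: "\<alpha> \<in> positive_roots" "\<beta> \<in> positive_roots" "reflection \<alpha> = reflection \<beta>" for \<alpha> \<beta>
  proof -
    have "hyperplane \<alpha> = hyperplane \<beta>"
      using ab hyperplane_eq_iff_reflection_eq by (auto simp: positive_roots_def)
    then obtain k where "0 < k" "\<beta> = k *\<^sub>R \<alpha>" using positive_roots_same_hyperplane[OF ab(1,2)] by blast
    then show ?thesis by (auto simp: half_def zero_le_mult_iff)
  qed
  have "half ` positive_roots \<subseteq> (\<lambda>t. half (SOME \<alpha>. \<alpha> \<in> positive_roots \<and> reflection \<alpha> = t)) ` W"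
  proof
    fix h assume "h \<in> half ` positive_roots"
    then obtain \<alpha> where a: "\<alpha> \<in> positive_roots" "h = half \<alpha>" by auto
    let ?\<beta> = "SOME \<beta>. \<beta> \<in> positive_roots \<and> reflection \<beta> = reflection \<alpha>"
    have "?\<beta> \<in> positive_roots \<and> reflection ?\<beta> = reflection \<alpha>"
      by (rule someI_ex) (use a in auto)
    then have "h = half ?\<beta>" using half_eq a by metis
    moreover have "reflection \<alpha> \<in> W" using a by (auto simp: positive_roots_def)
    ultimately show "h \<in> (\<lambda>t. half (SOME \<alpha>. \<alpha> \<in> positive_roots \<and> reflection \<alpha> = t)) ` W" by blast
  qed
  then have fin: "finite (half ` positive_roots)" using finite_W finite_surj by blast
  \<comment> \<open>Half-spaces and not roots are counted here: positive multiples of a root give the same half-space.\<close>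
  define \<M> where "\<M> = {M. M \<subseteq> half ` positive_roots \<and> \<Inter>M = closure F}"
  have "half ` positive_roots \<in> \<M>" by (auto simp: \<M>_def half_def closure_chamber)
  moreover have "finite \<M>" using fin by (simp add: \<M>_def)
  ultimately obtain M where "M \<in> \<M>" and min: "\<forall>M'\<in>\<M>. M' \<subseteq> M \<longrightarrow> M = M'"
    using finite_has_minimal[of \<M>] by auto
  then have M: "M \<subseteq> half ` positive_roots" "\<Inter>M = closure F" by (auto simp: \<M>_def)
  have facet: "C facet_of closure F \<longleftrightarrow> (\<exists>h. h \<in> M \<and> C = closure F \<inter> {x. - normal h \<bullet> x = 0})" for C
  proof (rule facet_of_polyhedron_explicit)
    show "finite M" using M fin finite_subset by blast
    show "closure F = affine hull closure F \<inter> \<Inter>M" using M affine_hull_closure_chamber by simp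
    show "- normal h \<noteq> 0 \<and> h = {x. - normal h \<bullet> x \<le> 0}" if "h \<in> M" for h
      using normal[of h] that M by (auto simp: positive_roots_def half_def inner_commute)
    show "closure F \<subset> affine hull closure F \<inter> \<Inter>M'" if "M' \<subset> M" for M'
    proof -
      have "M' \<notin> \<M>" using min that by blast
      moreover have "M' \<subseteq> half ` positive_roots" using that M(1) by blast
      ultimately have "\<Inter>M' \<noteq> closure F" unfolding \<M>_def by blast
      moreover have "closure F \<subseteq> \<Inter>M'" using that M(2) by auto
      ultimately show ?thesis using affine_hull_closure_chamber by auto
    qed
  qed
  have "v \<in> h" if h: "h \<in> M" for h
  proof -
    let ?\<alpha> = "normal h"
    have a: "?\<alpha> \<in> positive_roots" "half ?\<alpha> = h" using normal h M by auto
    have "closure F \<inter> {x. - ?\<alpha> \<bullet> x = 0} = hyperplane ?\<alpha> \<inter> closure F"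
      by (auto simp: hyperplane_def inner_commute)
    then have "(hyperplane ?\<alpha> \<inter> closure F) facet_of closure F"
      using facet h by metis
    then have "hyperplane ?\<alpha> \<in> walls W F"
      using a by (auto simp: walls_def reflecting_hyperplanes_def positive_roots_def)
    with v a show ?thesis by (auto simp: half_def)
  qed
  then show ?thesis using M(2) by auto
qed

lemma simple_roots_positive:
  assumes "\<alpha> \<in> simple_roots W \<Phi> F"
  shows "\<alpha> \<in> positive_roots"
proof -
  have wall: "hyperplane \<alpha> \<in> reflecting_hyperplanes W" and pos: "0 < \<rho> \<bullet> \<alpha>"
    using assms base_point by (auto simp: simple_roots_def walls_def)
  obtain \<gamma> where \<gamma>: "\<gamma> \<noteq> 0" "reflection \<gamma> \<in> W" "hyperplane \<alpha> = hyperplane \<gamma>"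
    using wall by (auto simp: reflecting_hyperplanes_def)
  have "\<alpha> \<noteq> 0" using pos by auto
  then show ?thesis
    using \<gamma> pos hyperplane_eq_iff_reflection_eq[of \<alpha> \<gamma>] by (auto simp: positive_roots_def)
qed

lemma root_system_pair:
  assumes "root_system W \<Phi>" "H \<in> reflecting_hyperplanes W"
  shows "\<exists>\<gamma>. \<gamma> \<noteq> 0 \<and> {\<delta> \<in> \<Phi>. hyperplane \<delta> = H} = {\<gamma>, - \<gamma>}"
proof -
  have "\<forall>H\<in>reflecting_hyperplanes W. \<exists>\<gamma>. \<gamma> \<noteq> 0 \<and> {\<delta> \<in> \<Phi>. hyperplane \<delta> = H} = {\<gamma>, - \<gamma>}"
    using assms(1) unfolding root_system_def by (elim conjE)
  from bspec[OF this assms(2)] show ?thesis .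
qed

text \<open>A point \<open>p\<close> of the wall of \<open>\<alpha>\<close> with \<open>p \<bullet> \<beta> > 0\<close> is fixed by the reflection in \<open>\<alpha>\<close>, so it has the same
  positive product with the reflected \<open>\<beta>\<close>, which is therefore a positive root. Obtuseness follows from
  this with a point of the wall of \<open>\<beta>\<close>: if \<open>\<alpha> \<bullet> \<beta>\<close> were positive, the reflected \<open>\<beta>\<close> would be negative
  there.\<close>

lemma simple_system_simple_roots:
  assumes "root_system W \<Phi>"
  shows "simple_system W \<rho> (simple_roots W \<Phi> F)"
proof -
  let ?\<Delta> = "simple_roots W \<Phi> F"
  interpret regular_point W \<rho>
    using reflection_group chamber_regular[OF base_point] by unfold_locales
  have pos_iff: "\<beta> \<in> positive_roots \<longleftrightarrow> is_root \<beta> \<and> 0 < \<rho> \<bullet> \<beta>" for \<beta>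
    by (auto simp: positive_roots_def is_root_def)
  have wall: "hyperplane \<alpha> \<in> walls W F" if "\<alpha> \<in> ?\<Delta>" for \<alpha>
    using that by (simp add: simple_roots_def)
  have ne: "hyperplane \<alpha> \<noteq> hyperplane \<beta>" if ab: "\<alpha> \<in> ?\<Delta>" "\<beta> \<in> ?\<Delta>" "\<alpha> \<noteq> \<beta>" for \<alpha> \<beta>
  proof
    assume eq: "hyperplane \<alpha> = hyperplane \<beta>"
    have "hyperplane \<alpha> \<in> reflecting_hyperplanes W" using wall[OF ab(1)] by (simp add: walls_def)
    from root_system_pair[OF assms this] obtain \<gamma>
      where "\<gamma> \<noteq> 0 \<and> {\<delta> \<in> \<Phi>. hyperplane \<delta> = hyperplane \<alpha>} = {\<gamma>, - \<gamma>}" ..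
    then have "{\<delta> \<in> \<Phi>. hyperplane \<delta> = hyperplane \<alpha>} = {\<gamma>, - \<gamma>}" by simp
    then have "\<alpha> \<in> {\<gamma>, - \<gamma>}" "\<beta> \<in> {\<gamma>, - \<gamma>}"
      using ab eq by (auto simp: simple_roots_def)
    moreover have "0 < \<rho> \<bullet> \<alpha>" "0 < \<rho> \<bullet> \<beta>"
      using simple_roots_positive ab by (auto simp: positive_roots_def)
    ultimately show False using ab(3) by auto
  qed
  have refl_pos: "0 < \<rho> \<bullet> reflection \<alpha> \<beta> \<and> (\<exists>p\<in>closure F. p \<bullet> \<alpha> = 0 \<and> 0 < p \<bullet> \<beta>)"
    if ab: "\<alpha> \<in> ?\<Delta>" "\<beta> \<in> positive_roots" "hyperplane \<alpha> \<noteq> hyperplane \<beta>" for \<alpha> \<beta>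
  proof -
    obtain p where p: "p \<in> closure F" "p \<bullet> \<alpha> = 0" "0 < p \<bullet> \<beta>"
      using wall_point[OF simple_roots_positive wall] ab by blast
    have "reflection \<alpha> \<in> W" using simple_roots_positive[OF ab(1)] by (simp add: positive_roots_def)
    then have r: "is_root (reflection \<alpha> \<beta>)" using ab(2) pos_iff is_root_image by blast
    have "p \<bullet> reflection \<alpha> \<beta> = p \<bullet> \<beta>"
      using p(2) by (simp add: reflection_alt inner_diff_right)
    then have "- reflection \<alpha> \<beta> \<notin> positive_roots"
      using p closure_chamber by force
    then have "0 < \<rho> \<bullet> reflection \<alpha> \<beta>"
      using positive_or_negative[of "reflection \<alpha> \<beta>"] r by (auto simp: positive_roots_def is_root_def)
    with p show ?thesis by blast
  qed
  show ?thesis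
  proof
    fix \<alpha> assume a: "\<alpha> \<in> ?\<Delta>"
    show "is_root \<alpha>" "0 < \<rho> \<bullet> \<alpha>" using simple_roots_positive[OF a] pos_iff by auto
    show "0 < \<rho> \<bullet> reflection \<alpha> \<beta>"
      if "is_root \<beta>" "0 < \<rho> \<bullet> \<beta>" "reflection \<beta> \<noteq> reflection \<alpha>" for \<beta>
      using refl_pos[OF a, of \<beta>] that pos_iff hyperplane_eq_iff_reflection_eq[of \<alpha> \<beta>] \<open>is_root \<alpha>\<close>
      by (auto simp: is_root_def)
    show "\<alpha> \<bullet> \<beta> \<le> 0" if b: "\<beta> \<in> ?\<Delta>" "\<alpha> \<noteq> \<beta>" for \<beta>
    proof -
      have ab: "\<alpha> \<in> positive_roots" "\<beta> \<in> positive_roots" using simple_roots_positive a b by auto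
      obtain p where p: "p \<in> closure F" "p \<bullet> \<beta> = 0" "0 < p \<bullet> \<alpha>"
        using refl_pos[of \<beta> \<alpha>] ne[of \<beta> \<alpha>] a b ab by auto
      have "reflection \<alpha> \<beta> \<in> positive_roots"
        using refl_pos[of \<alpha> \<beta>] ne[of \<alpha> \<beta>] a b ab pos_iff is_root_image[of \<beta> "reflection \<alpha>"]
        by (auto simp: positive_roots_def)
      then have "0 \<le> p \<bullet> reflection \<alpha> \<beta>" using p(1) closure_chamber by auto
      then have "2 * (\<beta> \<bullet> \<alpha>) / (\<alpha> \<bullet> \<alpha>) * (p \<bullet> \<alpha>) \<le> 0"
        using p(2) by (simp add: reflection_alt inner_diff_right)
      moreover have "0 < \<alpha> \<bullet> \<alpha>" using ab by (simp add: positive_roots_def)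
      ultimately have "\<beta> \<bullet> \<alpha> \<le> 0"
        using p(3) by (simp add: mult_le_0_iff divide_le_0_iff)
      then show ?thesis by (simp add: inner_commute)
    qed
  next
    fix v \<beta> assume v: "\<And>\<alpha>. \<alpha> \<in> ?\<Delta> \<Longrightarrow> 0 \<le> v \<bullet> \<alpha>" and b: "is_root \<beta>" "0 < \<rho> \<bullet> \<beta>"
    have "v \<in> closure F"
    proof (rule walls_dominant)
      fix \<alpha> assume a: "\<alpha> \<in> positive_roots" "hyperplane \<alpha> \<in> walls W F"
      then have "hyperplane \<alpha> \<in> reflecting_hyperplanes W" by (simp add: walls_def)
      from root_system_pair[OF assms this] obtain \<gamma>
        where g: "\<gamma> \<noteq> 0 \<and> {\<delta> \<in> \<Phi>. hyperplane \<delta> = hyperplane \<alpha>} = {\<gamma>, - \<gamma>}" ..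
      then have "\<gamma> \<in> \<Phi>" "hyperplane \<gamma> = hyperplane \<alpha>" "- \<gamma> \<in> \<Phi>" "hyperplane (- \<gamma>) = hyperplane \<alpha>"
        by blast+
      moreover have "\<gamma> \<noteq> 0" using g by simp
      moreover from this have "reflection \<gamma> = reflection \<alpha>"
        using \<open>hyperplane \<gamma> = hyperplane \<alpha>\<close> a(1) hyperplane_eq_iff_reflection_eq[of \<gamma> \<alpha>]
        by (simp add: positive_roots_def)
      ultimately obtain \<delta> where d: "\<delta> \<in> \<Phi>" "hyperplane \<delta> = hyperplane \<alpha>" "\<delta> \<in> positive_roots"
        using positive_or_negative[of \<gamma>] a(1) by (auto simp: positive_roots_def)
      then have "\<delta> \<in> ?\<Delta>" using a(2) chamber_positive by (simp add: simple_roots_def)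
      then have "0 \<le> v \<bullet> \<delta>" by (rule v)
      moreover obtain k where "0 < k" "\<delta> = k *\<^sub>R \<alpha>"
        using positive_roots_same_hyperplane[OF a(1) d(3) d(2)[symmetric]] by blast
      ultimately show "0 \<le> v \<bullet> \<alpha>" by (simp add: zero_le_mult_iff)
    qed
    then show "0 \<le> v \<bullet> \<beta>" using closure_chamber pos_iff b by auto
  qed
qed

end

section \<open>Factorizations of Coxeter elements\<close>

theorem theorem1p1:
  fixes W :: "('a::euclidean_space \<Rightarrow> 'a) set"
    and c :: "'a \<Rightarrow> 'a"
    and ts ts' :: "('a \<Rightarrow> 'a) list"
  assumes "finite_reflection_group W"
    and "essential W"
    and "coxeter_element W c"
    and "reflection_factorization W c ts"
    and "reflection_factorization W c ts'"
  shows "same_hurwitz_orbit (map_group W) ts ts' \<longleftrightarrow>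
    image_mset (conj_class (map_group W)) (mset ts) =
    image_mset (conj_class (map_group W)) (mset ts')"
proof -
  obtain \<Phi> F \<alpha>s where \<Phi>: "root_system W \<Phi>" and F: "weyl_chamber W F"
    and \<alpha>s: "distinct \<alpha>s" "set \<alpha>s = simple_roots W \<Phi> F"
    and c: "c = list_prod (map_group W) (map reflection \<alpha>s)"
    using assms(3) unfolding coxeter_element_def by blast
  obtain \<rho> where "\<rho> \<in> F"
    using F in_components_nonempty by (fastforce simp: weyl_chamber_def)
  then interpret chamber W F \<rho>
    using assms(1) F by unfold_locales
  interpret simple_system W \<rho> "simple_roots W \<Phi> F"
    by (rule simple_system_simple_roots[OF \<Phi>])
  show ?thesis
    using hurwitz_iff_conj_classes[OF \<alpha>s] assms(4,5) c
    by (simp add: reflection_factorization_def)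
qed

end
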